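(* Let $q$ be a prime power, and let $k,g,f,x,y$ be positive integers with $k<q$. (i) If $p$ is a prime with $k<p$, then $C(2k^2,p^2-p) \geq k(p-1)$; (ii) $C(2k^2,q^2-1) \geq kq$; (iii) $C(2k^2,q^2+q+1) \geq kq+1$; (iv) if $\gcd(x,y)=1$, then $C(gf,xy)\geq C(g,x)\,C(f,y)$; (v) $R(gf,xy) \geq R\!\left(gf,\,xy+1-\left\lceil \tfrac{y}{C(f,y)}\right\rceil\right) \geq R(g,x)\,C(f,y)$; (vi) $R(g,3g-\lfloor g/3\rfloor+1) \geq g+2\lfloor g/3\rfloor+\lfloor g/6\rfloor$.
   Context: $[n]=\{1,2,\dots,n\}$ and $\mathbb{Z}_n$ denotes the integers modulo $n$. For a finite set $S$ contained in $A=\mathbb{Z}$ or $A=\mathbb{Z}_n$ and $m\in A$, let $S\ast S(m)=|\{(s_1,s_2): s_1,s_2\in S,\ s_1+s_2=m\}|$ be the number of ordered pairs of elements of $S$ with sum $m$ (addition in $A$), and let $\|S\ast S\|_\infty=\max_{m\in A} S\ast S(m)$. For positive integers $g,n$, define $R(g,n)=\max\{|S| : S\subseteq[n],\ \|S\ast S\|_\infty\le g\}$ (sums taken in $\mathbb{Z}$) and $C(g,n)=\max\{|S| : S\subseteq\mathbb{Z}_n,\ \|S\ast S\|_\infty\le g\}$ (sums taken modulo $n$). *)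

theory Defs
  imports Complex_Main "HOL-Algebra.IntRing" "HOL-Number_Theory.Number_Theory"
begin

definition conv :: "int ring \<Rightarrow> int set \<Rightarrow> int \<Rightarrow> nat" where
  "conv A S m = card {(s1, s2). s1 \<in> S \<and> s2 \<in> S \<and> s1 \<oplus>\<^bsub>A\<^esub> s2 = m}"

definition conv_norm :: "int ring \<Rightarrow> int set \<Rightarrow> nat" where
  "conv_norm A S = Max (conv A S ` carrier A)"

definition R :: "nat \<Rightarrow> nat \<Rightarrow> nat" where
  "R g n = Max {card S | S. S \<subseteq> {1..int n} \<and> conv_norm \<Z> S \<le> g}"

(* The integers modulo n are residue_ring n: representatives 0..n-1, addition reduced mod n. *)
definition C :: "nat \<Rightarrow> nat \<Rightarrow> nat" where
  "C g n = Max {card S | S. S \<subseteq> carrier (residue_ring (int n)) \<and>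
                             conv_norm (residue_ring (int n)) S \<le> g}"

(* The maxima above are over finite nonempty sets (carrier nonempty means n > 0 for C),
   so Max is a genuine maximum. *)

lemma conv_le:
  assumes "finite S" shows "conv A S m \<le> card S * card S"
proof -
  have "{(s1, s2). s1 \<in> S \<and> s2 \<in> S \<and> s1 \<oplus>\<^bsub>A\<^esub> s2 = m} \<subseteq> S \<times> S" by auto
  then show ?thesis
    unfolding conv_def card_cartesian_product[symmetric]
    by (rule card_mono[rotated]) (simp add: assms)
qed

lemma conv_norm_le_iff:
  assumes "finite S" "carrier A \<noteq> {}"
  shows "conv_norm A S \<le> g \<longleftrightarrow> (\<forall>m\<in>carrier A. conv A S m \<le> g)"
proof -
  have "conv A S ` carrier A \<subseteq> {..card S * card S}"
    using conv_le[OF assms(1)] by auto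
  then have "finite (conv A S ` carrier A)" by (rule finite_subset) simp
  then show ?thesis unfolding conv_norm_def by (subst Max_le_iff) (auto simp: assms(2))
qed

lemma card_set_finite_nonempty:
  assumes "finite U" "carrier A \<noteq> {}"
  shows "finite {card S | S. S \<subseteq> U \<and> conv_norm A S \<le> g}"
    and "{card S | S. S \<subseteq> U \<and> conv_norm A S \<le> g} \<noteq> {}"
proof -
  have "{card S | S. S \<subseteq> U \<and> conv_norm A S \<le> g} \<subseteq> card ` Pow U" by auto
  then show "finite {card S | S. S \<subseteq> U \<and> conv_norm A S \<le> g}"
    by (rule finite_subset) (simp add: assms(1))
  have "conv_norm A {} \<le> g"
    by (subst conv_norm_le_iff) (simp_all add: assms(2) conv_def)
  then show "{card S | S. S \<subseteq> U \<and> conv_norm A S \<le> g} \<noteq> {}" by blast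
qed

end

theory Submission
  imports Defs
    "HOL-Computational_Algebra.Polynomial"
    "HOL-Number_Theory.Residue_Primitive_Roots"
begin

text \<open>
  The lower bounds for \<open>C (2 * k\<^sup>2)\<close> come from one mechanism, \<open>card_UN_le_C\<close>: if a set of
  residues is a union of \<open>k\<close> pieces and, for each ordered pair of pieces, every residue has at most
  two representations as a sum of an element of the first and an element of the second, then every
  residue has at most \<open>2 * k\<^sup>2\<close> representations over the whole set. In each construction the
  pieces are discrete logarithms, so that sums of residues become products in a field, and the bound
  two is the number of roots of a quadratic equation.

  For Ruzsa's construction, \<open>p * (p - 1)\<close> splits into coprime factors and the piece with index \<open>c\<close>
  consists of the residues that are \<open>i\<close> modulo \<open>p - 1\<close> and \<open>c * w ^ i\<close> modulo \<open>p\<close>, where \<open>w\<close> is a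
  primitive root: the two components of a sum determine the sum and the product of
  \<open>c * w ^ i\<close> and \<open>d * w ^ j\<close>.
  For Bose's construction, the piece with index \<open>a \<noteq> 0\<close> consists of the logarithms of
  \<open>a * X + c\<close>, where \<open>c\<close> ranges over the field with \<open>q\<close> elements and \<open>X\<close> generates the
  multiplicative group of the field with \<open>q\<^sup>2\<close> elements.
  For Singer's construction, logarithms in the field with \<open>q ^ 3\<close> elements are taken modulo
  \<open>q\<^sup>2 + q + 1\<close>, that is, up to factors from the field with \<open>q\<close> elements; the pieces are lines of the
  projective plane through one common point. If three points \<open>s\<^sub>i\<close> of one line had partners \<open>t\<^sub>i\<close> on
  another line with all products \<open>s\<^sub>i * t\<^sub>i\<close> proportional, then a linear relation between the \<open>t\<^sub>i\<close>
  would turn into a quadratic equation for \<open>s\<^sub>1 / s\<^sub>2\<close> over the field with \<open>q\<close> elements; but an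
  element outside that field has three distinct conjugates, so it satisfies none
  (\<open>singer_three\<close>).

  The fields are obtained without a type of field elements: \<open>exists_finite_field\<close> produces a
  prime ideal \<open>P\<close> of the ring of integer polynomials modulo which every element outside \<open>P\<close> is a power of
  the variable. It is a maximal ideal above the ideal of those \<open>f\<close> for which \<open>f(\<zeta>)\<close> is a multiple of
  \<open>p\<close> in \<open>\<int>[\<zeta>]\<close>, for a complex primitive root of unity \<open>\<zeta>\<close> of order one less than the size of the
  field. The computations take place in the polynomial ring, with congruence modulo \<open>P\<close> in place of
  equality.

  The product inequality for \<open>C\<close> is the Chinese remainder theorem. The inequality between \<open>R\<close> and
  \<open>C\<close> combines quotients from an integer set with remainders from a modular set, after the modular
  set has been rotated so that a long cyclic gap lies at the end. The last bound is an explicit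
  set made of three intervals and one progression of difference two (\<open>R_ge_four_blocks\<close>).
\<close>

section \<open>Representation counts and the two extremal functions\<close>

lemma finite_pairs: "finite A \<Longrightarrow> finite B \<Longrightarrow> finite {(s, t). s \<in> A \<and> t \<in> B \<and> P s t}"
  by (rule finite_subset[of _ "A \<times> B"]) auto

lemma cong_imp_eq_on_interval:
  fixes a b n :: int
  assumes "[a = b] (mod n)" "a \<in> {0..<n}" "b \<in> {0..<n}"
  shows "a = b"
  using assms by (intro cong_less_imp_eq_int[of a n b]) auto

lemma conv_norm_residue_ring_le_iff:
  assumes "finite S" "n > 0"
  shows "conv_norm (residue_ring (int n)) S \<le> g \<longleftrightarrow>
    (\<forall>m. card {(s, t). s \<in> S \<and> t \<in> S \<and> [s + t = m] (mod int n)} \<le> g)" (is "?l \<longleftrightarrow> ?r")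
proof -
  have *: "conv (residue_ring (int n)) S (m mod int n) =
      card {(s, t). s \<in> S \<and> t \<in> S \<and> [s + t = m] (mod int n)}" for m
    by (simp add: conv_def residue_ring_def cong_def)
  have "carrier (residue_ring (int n)) = (\<lambda>m. m mod int n) ` UNIV"
  proof -
    have "m \<in> range (\<lambda>m. m mod int n)" if "m \<in> {0..int n - 1}" for m
      using that by (intro range_eqI[of _ _ m]) simp
    then show ?thesis using assms(2) by (auto simp: residue_ring_def)
  qed
  then show ?thesis
    using assms by (subst conv_norm_le_iff) (auto simp: *)
qed

lemma conv_norm_int_le_iff:
  assumes "finite S"
  shows "conv_norm \<Z> S \<le> g \<longleftrightarrow>
    (\<forall>m. card {(s, t). s \<in> S \<and> t \<in> S \<and> s + t = m} \<le> g)"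
  using assms by (subst conv_norm_le_iff) (auto simp: conv_def)

lemma card_le_R:
  assumes "S \<subseteq> {1..int n}"
    and "\<And>m. card {(s, t). s \<in> S \<and> t \<in> S \<and> s + t = m} \<le> g"
  shows "card S \<le> R g n"
proof -
  have fin: "finite {card S | S. S \<subseteq> {1..int n} \<and> conv_norm \<Z> S \<le> g}"
    by (rule card_set_finite_nonempty) auto
  have "finite S" using assms(1) by (rule finite_subset) simp
  with assms show ?thesis
    unfolding R_def by (intro Max_ge[OF fin]) (auto simp: conv_norm_int_le_iff)
qed

lemma R_attained:
  obtains S where "S \<subseteq> {1..int n}" "card S = R g n"
    "\<And>m. card {(s, t). s \<in> S \<and> t \<in> S \<and> s + t = m} \<le> g"
proof -
  have "R g n \<in> {card S | S. S \<subseteq> {1..int n} \<and> conv_norm \<Z> S \<le> g}"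
    unfolding R_def by (rule Max_in) (rule card_set_finite_nonempty; simp)+
  then obtain S where S: "S \<subseteq> {1..int n}" "card S = R g n" "conv_norm \<Z> S \<le> g" by auto
  moreover have "finite S" using S(1) by (rule finite_subset) simp
  ultimately show ?thesis using that by (auto simp: conv_norm_int_le_iff)
qed

lemma C_attained:
  assumes "n > 0"
  obtains S where "S \<subseteq> {0..<int n}" "card S = C g n"
    "\<And>m. card {(s, t). s \<in> S \<and> t \<in> S \<and> [s + t = m] (mod int n)} \<le> g"
proof -
  have "C g n \<in> {card S | S. S \<subseteq> carrier (residue_ring (int n)) \<and>
      conv_norm (residue_ring (int n)) S \<le> g}"
    unfolding C_def using assms
    by (intro Max_in card_set_finite_nonempty) (auto simp: residue_ring_def)
  then obtain S where S: "S \<subseteq> {0..int n - 1}" "card S = C g n"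
    "conv_norm (residue_ring (int n)) S \<le> g"
    by (auto simp: residue_ring_def)
  moreover have "finite S" using S(1) by (rule finite_subset) simp
  moreover have "{0..int n - 1} = {0..<int n}" by auto
  ultimately show ?thesis using that assms by (auto simp: conv_norm_residue_ring_le_iff)
qed

text \<open>The set of residues may be given by labels: a set of an arbitrary type together with a map to
  the integers that is injective modulo \<open>n\<close>.\<close>

lemma card_le_C:
  fixes f :: "'a \<Rightarrow> int"
  assumes "n > 0" "finite S"
    and inj: "\<And>s t. s \<in> S \<Longrightarrow> t \<in> S \<Longrightarrow> [f s = f t] (mod int n) \<Longrightarrow> s = t"
    and bound: "\<And>m. card {(s, t). s \<in> S \<and> t \<in> S \<and> [f s + f t = m] (mod int n)} \<le> g"
  shows "card S \<le> C g n"
proof -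
  define h where "h s = f s mod int n" for s
  have injh: "inj_on h S" using inj by (auto simp: inj_on_def h_def cong_def)
  have "card {(s, t). s \<in> h ` S \<and> t \<in> h ` S \<and> [s + t = m] (mod int n)} \<le> g" for m
  proof -
    have "{(s, t). s \<in> h ` S \<and> t \<in> h ` S \<and> [s + t = m] (mod int n)} \<subseteq>
        map_prod h h ` {(s, t). s \<in> S \<and> t \<in> S \<and> [f s + f t = m] (mod int n)}" (is "_ \<subseteq> map_prod h h ` ?T")
    proof clarify
      fix s t assume "s \<in> S" "t \<in> S" "[h s + h t = m] (mod int n)"
      then show "(h s, h t) \<in> map_prod h h ` ?T"
        by (intro image_eqI[of _ _ "(s, t)"]) (auto simp: h_def cong_def mod_simps)
    qed
    moreover have "finite {(s, t). s \<in> S \<and> t \<in> S \<and> [f s + f t = m] (mod int n)}"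
      by (rule finite_subset[of _ "S \<times> S"]) (use \<open>finite S\<close> in auto)
    ultimately have "card {(s, t). s \<in> h ` S \<and> t \<in> h ` S \<and> [s + t = m] (mod int n)} \<le> card (map_prod h h ` ?T)"
      by (intro card_mono) auto
    also have "\<dots> \<le> card {(s, t). s \<in> S \<and> t \<in> S \<and> [f s + f t = m] (mod int n)}"
      by (rule card_image_le, rule finite_subset[of _ "S \<times> S"]) (use \<open>finite S\<close> in auto)
    finally show ?thesis using bound[of m] by simp
  qed
  then have "conv_norm (residue_ring (int n)) (h ` S) \<le> g"
    using assms by (subst conv_norm_residue_ring_le_iff) auto
  moreover have "h ` S \<subseteq> carrier (residue_ring (int n))"
    using \<open>n > 0\<close> by (auto simp: h_def residue_ring_def)
  ultimately have "card (h ` S) \<le> C g n"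
    unfolding C_def using \<open>n > 0\<close>
    by (intro Max_ge card_set_finite_nonempty) (auto simp: residue_ring_def)
  then show ?thesis by (simp add: card_image injh)
qed

lemma card_le_2I:
  assumes "finite A"
    and "\<And>a b c. a \<in> A \<Longrightarrow> b \<in> A \<Longrightarrow> c \<in> A \<Longrightarrow> a = b \<or> a = c \<or> b = c"
  shows "card A \<le> 2"
proof (rule ccontr)
  assume "\<not> card A \<le> 2"
  then have "3 \<le> card A" by simp
  then obtain B where "B \<subseteq> A" "card B = 3" by (metis obtain_subset_with_card_n)
  then obtain a b c where "a \<in> A" "b \<in> A" "c \<in> A" "a \<noteq> b" "a \<noteq> c" "b \<noteq> c"
    unfolding card_3_iff by blast
  then show False using assms(2) by blast
qed

text \<open>The mechanism behind the algebraic constructions: a union of \<open>k\<close> pieces such that any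
  residue has at most two representations \<open>s + t\<close> with \<open>s\<close> in one prescribed piece and \<open>t\<close> in
  another. The pieces may overlap.\<close>

lemma card_UN_le_C:
  fixes f :: "'a \<Rightarrow> int"
  assumes "n > 0" "finite K" "\<And>a. a \<in> K \<Longrightarrow> finite (L a)"
    and inj: "\<And>s t. s \<in> (\<Union>a\<in>K. L a) \<Longrightarrow> t \<in> (\<Union>a\<in>K. L a) \<Longrightarrow> [f s = f t] (mod int n) \<Longrightarrow> s = t"
    and three: "\<And>a b s1 s2 s3 t1 t2 t3. a \<in> K \<Longrightarrow> b \<in> K \<Longrightarrow> {s1, s2, s3} \<subseteq> L a \<Longrightarrow> {t1, t2, t3} \<subseteq> L b \<Longrightarrow>
       [f s1 + f t1 = f s2 + f t2] (mod int n) \<Longrightarrow> [f s1 + f t1 = f s3 + f t3] (mod int n) \<Longrightarrow>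
       s1 = s2 \<or> s1 = s3 \<or> s2 = s3"
  shows "card (\<Union>a\<in>K. L a) \<le> C (2 * (card K)\<^sup>2) n"
proof (rule card_le_C)
  show "finite (\<Union>a\<in>K. L a)" using assms by auto
  fix m
  define T where "T = (\<lambda>(a, b). {(s, t). s \<in> L a \<and> t \<in> L b \<and> [f s + f t = m] (mod int n)})"
  have "card (T z) \<le> 2" if KK: "z \<in> K \<times> K" for z
  proof -
    obtain a b where z: "z = (a, b)" "a \<in> K" "b \<in> K" using KK by blast
    have fin: "finite (T z)"
      by (rule finite_subset[of _ "L a \<times> L b"]) (use z assms(3) in \<open>auto simp: T_def\<close>)
    \<comment> \<open>the first summand determines the second one\<close>
    have "inj_on fst (T z)"
    proof (rule inj_onI)
      fix u v assume uv: "u \<in> T z" "v \<in> T z" "fst u = fst v"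
      then have "[f (fst u) + f (snd u) = f (fst u) + f (snd v)] (mod int n)"
        by (auto simp: T_def z cong_def)
      then have "[f (snd u) = f (snd v)] (mod int n)" by (simp add: cong_add_lcancel)
      then have "snd u = snd v" using uv z by (intro inj) (auto simp: T_def)
      with uv show "u = v" by (simp add: prod_eq_iff)
    qed
    moreover have "card (fst ` T z) \<le> 2"
    proof (rule card_le_2I)
      fix s1 s2 s3 assume "s1 \<in> fst ` T z" "s2 \<in> fst ` T z" "s3 \<in> fst ` T z"
      then obtain t1 t2 t3 where t: "(s1, t1) \<in> T z" "(s2, t2) \<in> T z" "(s3, t3) \<in> T z" by auto
      then show "s1 = s2 \<or> s1 = s3 \<or> s2 = s3"
        using z by (intro three[of a b s1 s2 s3 t1 t2 t3]) (auto simp: T_def cong_def)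
    qed (use fin in auto)
    ultimately show ?thesis by (simp add: card_image)
  qed
  note T2 = this
  have finT: "finite (T z)" if "z \<in> K \<times> K" for z
    by (rule finite_subset[of _ "L (fst z) \<times> L (snd z)"]) (use that assms(3) in \<open>auto simp: T_def\<close>)
  have "{(s, t). s \<in> (\<Union>a\<in>K. L a) \<and> t \<in> (\<Union>a\<in>K. L a) \<and> [f s + f t = m] (mod int n)} \<subseteq> (\<Union>z\<in>K \<times> K. T z)"
    by (auto simp: T_def)
  then have "card {(s, t). s \<in> (\<Union>a\<in>K. L a) \<and> t \<in> (\<Union>a\<in>K. L a) \<and> [f s + f t = m] (mod int n)} \<le>
      card (\<Union>z\<in>K \<times> K. T z)"
    using finT \<open>finite K\<close> by (intro card_mono) auto
  also have "\<dots> \<le> (\<Sum>z\<in>K \<times> K. card (T z))" using \<open>finite K\<close> by (intro card_UN_le) auto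
  also have "\<dots> \<le> (\<Sum>z\<in>K \<times> K. 2)" using T2 by (intro sum_mono) blast
  also have "\<dots> = 2 * (card K)\<^sup>2" by (simp add: card_cartesian_product power2_eq_square)
  finally show "card {(s, t). s \<in> (\<Union>a\<in>K. L a) \<and> t \<in> (\<Union>a\<in>K. L a) \<and> [f s + f t = m] (mod int n)} \<le>
    2 * (card K)\<^sup>2" .
qed (use assms in auto)

section \<open>Products and dilations\<close>

lemma C_mult_ge:
  assumes "x > 0" "y > 0" "coprime x y"
  shows "C g x * C f y \<le> C (g * f) (x * y)"
proof -
  obtain A where A: "A \<subseteq> {0..<int x}" "card A = C g x"
    "\<And>m. card {(s, t). s \<in> A \<and> t \<in> A \<and> [s + t = m] (mod int x)} \<le> g"
    by (rule C_attained[OF assms(1), where g = g]) (rule that, auto)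
  obtain B where B: "B \<subseteq> {0..<int y}" "card B = C f y"
    "\<And>m. card {(s, t). s \<in> B \<and> t \<in> B \<and> [s + t = m] (mod int y)} \<le> f"
    by (rule C_attained[OF assms(2), where g = f]) (rule that, auto)
  have fin: "finite A" "finite B" using A(1) B(1) finite_subset by blast+
  have cop: "coprime (int x) (int y)" using assms(3) by simp
  have "\<exists>z. [z = a] (mod int x) \<and> [z = b] (mod int y)" for a b
    using binary_chinese_remainder_int[OF cop, of a b] by auto
  then obtain h where h: "\<And>a b. [h a b = a] (mod int x)" "\<And>a b. [h a b = b] (mod int y)" by metis
  have "card (A \<times> B) \<le> C (g * f) (x * y)"
  proof (rule card_le_C[where f = "\<lambda>(a, b). h a b"])
    show "x * y > 0" "finite (A \<times> B)" using assms fin by auto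
  next
    fix s t assume st: "s \<in> A \<times> B" "t \<in> A \<times> B"
      "[(case s of (a, b) \<Rightarrow> h a b) = (case t of (a, b) \<Rightarrow> h a b)] (mod int (x * y))"
    obtain a b c d where s: "s = (a, b)" "t = (c, d)" by (cases s, cases t)
    have "[h a b = h c d] (mod int x)" "[h a b = h c d] (mod int y)"
      using st(3) s by (auto simp: cong_modulus_mult intro: cong_dvd_modulus)
    then have "[a = c] (mod int x)" "[b = d] (mod int y)"
      using h by (meson cong_sym cong_trans)+
    moreover have "a \<in> {0..<int x}" "c \<in> {0..<int x}" "b \<in> {0..<int y}" "d \<in> {0..<int y}"
      using st(1,2) A(1) B(1) s by auto
    ultimately have "a = c" "b = d" by (blast intro: cong_imp_eq_on_interval)+
    then show "s = t" using s by simp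
  next
    fix m
    let ?P = "{(s, t). s \<in> A \<times> B \<and> t \<in> A \<times> B \<and>
      [(case s of (a, b) \<Rightarrow> h a b) + (case t of (a, b) \<Rightarrow> h a b) = m] (mod int (x * y))}"
    let ?A = "{(s, t). s \<in> A \<and> t \<in> A \<and> [s + t = m] (mod int x)}"
    let ?B = "{(s, t). s \<in> B \<and> t \<in> B \<and> [s + t = m] (mod int y)}"
    let ?r = "\<lambda>((a, b), (c, d)). ((a, c), (b, d))"
    have "[a + c = m] (mod int x)" "[b + d = m] (mod int y)"
      if "[h a b + h c d = m] (mod int (x * y))" for a b c d
    proof -
      have "[h a b + h c d = m] (mod int x)" "[h a b + h c d = m] (mod int y)"
        using that by (auto intro: cong_dvd_modulus)
      then show "[a + c = m] (mod int x)" "[b + d = m] (mod int y)"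
        using h by (meson cong_add cong_sym cong_trans)+
    qed
    then have "?r ` ?P \<subseteq> ?A \<times> ?B" by auto
    moreover have "finite (?A \<times> ?B)"
      by (rule finite_subset[of _ "(A \<times> A) \<times> (B \<times> B)"]) (use fin in auto)
    moreover have "inj_on ?r ?P" by (auto simp: inj_on_def)
    ultimately have "card ?P \<le> card (?A \<times> ?B)"
      by (intro card_inj_on_le[of ?r])
    also have "\<dots> \<le> g * f"
      unfolding card_cartesian_product by (intro mult_le_mono A(3) B(3))
    finally show "card ?P \<le> g * f" .
  qed
  then show ?thesis by (simp add: card_cartesian_product A B)
qed

lemma R_mono:
  assumes "m \<le> n"
  shows "R g m \<le> R g n"
proof -
  obtain S where S: "S \<subseteq> {1..int m}" "card S = R g m"
    "\<And>m. card {(s, t). s \<in> S \<and> t \<in> S \<and> s + t = m} \<le> g"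
    by (rule R_attained) (rule that, auto)
  have "S \<subseteq> {1..int n}" using S(1) assms by auto
  then show ?thesis using card_le_R[of S n g] S by simp
qed

lemma C_pos:
  assumes "n > 0" "g > 0"
  shows "C g n > 0"
proof -
  have "card {0::int} \<le> C g n"
  proof (rule card_le_C[where f = "\<lambda>s. s"])
    fix m
    have "card {(s, t). s \<in> {0::int} \<and> t \<in> {0} \<and> [s + t = m] (mod int n)} \<le> card {(0::int, 0::int)}"
      by (rule card_mono) auto
    then show "card {(s, t). s \<in> {0::int} \<and> t \<in> {0} \<and> [s + t = m] (mod int n)} \<le> g"
      using assms by simp
  qed (use assms in auto)
  then show ?thesis by simp
qed

text \<open>A set of \<open>c\<close> residues modulo \<open>y\<close> leaves a cyclic gap of length at least \<open>y / c\<close>; rotating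
  that gap to the end makes the set fit into a short interval.\<close>

lemma exists_rotation_in_interval:
  fixes B :: "int set" and y L :: nat
  assumes "B \<subseteq> {0..<int y}" "card B * L < y"
  obtains c where "(\<lambda>b. (b + c) mod int y) ` B \<subseteq> {0..<int y - int L}"
proof -
  have fin: "finite B" using assms(1) finite_subset by blast
  \<comment> \<open>the end points of the windows of length \<open>L\<close> that meet \<open>B\<close>\<close>
  let ?E = "(\<lambda>(b, i). (b + int i) mod int y) ` (B \<times> {..<L})"
  have "card ?E \<le> card (B \<times> {..<L})" using fin by (intro card_image_le) auto
  also have "\<dots> < card {0..<int y}" using assms(2) by (simp add: card_cartesian_product)
  finally have "\<not> {0..<int y} \<subseteq> ?E" using fin by (metis card_mono finite_SigmaI finite_imageI finite_lessThan leD)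
  then obtain z where "z \<in> {0..<int y}" "z \<notin> ?E" by blast
  then have z: "0 \<le> z" "z < int y" "z \<notin> ?E" by simp_all
  have "(b + (- z - 1)) mod int y < int y - int L" if b: "b \<in> B" for b
  proof (rule ccontr)
    assume "\<not> (b + (- z - 1)) mod int y < int y - int L"
    then have ge: "(b - z - 1) mod int y \<ge> int y - int L" by (simp add: algebra_simps)
    define i where "i = nat (int y - 1 - (b - z - 1) mod int y)"
    have "(b - z - 1) mod int y < int y" using z by simp
    then have i: "int i = int y - 1 - (b - z - 1) mod int y" "i < L" using ge by (auto simp: i_def)
    have "(b + int i) mod int y = (b + (int y - 1 - (b - z - 1))) mod int y"
      unfolding i(1) by (metis (no_types, opaque_lifting) mod_add_right_eq mod_diff_right_eq)
    also have "\<dots> = z" using z by simp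
    finally show False using z(3) b i(2) by force
  qed
  moreover have "0 \<le> (b + (- z - 1)) mod int y" for b using z by simp
  ultimately show ?thesis using that[of "- z - 1"] by (auto simp: image_subset_iff)
qed

text \<open>The set \<open>y * (a - 1) + r b + 1\<close>, where \<open>a\<close> runs through an optimal set for \<open>R g x\<close> and \<open>b\<close>
  through an optimal set for \<open>C f y\<close> whose residues \<open>r b\<close> have been rotated to avoid the last
  \<open>\<lceil>y / C f y\<rceil> - 1\<close> residues.\<close>

lemma R_dilate_ge:
  assumes "y > 0" "f > 0"
  shows "R g x * C f y \<le> R (g * f) (x * y + 1 - nat \<lceil>real y / real (C f y)\<rceil>)"
proof -
  define N where "N = nat \<lceil>real y / real (C f y)\<rceil>"
  have Cp: "C f y > 0" using C_pos assms by blast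
  obtain A where A: "A \<subseteq> {1..int x}" "card A = R g x"
    "\<And>m. card {(s, t). s \<in> A \<and> t \<in> A \<and> s + t = m} \<le> g"
    by (rule R_attained) (rule that, auto)
  obtain B where B: "B \<subseteq> {0..<int y}" "card B = C f y"
    "\<And>m. card {(s, t). s \<in> B \<and> t \<in> B \<and> [s + t = m] (mod int y)} \<le> f"
    by (rule C_attained[OF assms(1), where g = f]) (rule that, auto)
  have fin: "finite A" "finite B" using A(1) B(1) finite_subset by blast+
  have N1: "N \<ge> 1" using assms Cp by (simp add: N_def Suc_le_eq)
  have "real (N - 1) < real y / real (C f y)"
    using N1 by (auto simp: N_def of_nat_diff nat_less_iff) linarith
  then have "real (C f y * (N - 1)) < real y" using Cp by (simp add: field_simps)
  then have "card B * (N - 1) < y" using B(2) by (metis of_nat_less_iff)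
  from exists_rotation_in_interval[OF B(1) this]
  obtain c where c: "(\<lambda>b. (b + c) mod int y) ` B \<subseteq> {0..<int y - int (N - 1)}" .
  define r where "r b = (b + c) mod int y" for b
  have r: "0 \<le> r b" "r b \<le> int y - int N" if "b \<in> B" for b
    using c that N1 by (auto simp: r_def image_subset_iff)
  have rb: "0 \<le> r b" "r b < int y" for b using assms by (auto simp: r_def)
  have injr: "b = b'" if "b \<in> B" "b' \<in> B" "r b = r b'" for b b'
  proof -
    have "[b = b'] (mod int y)"
      using that(3) by (simp add: r_def flip: cong_def) (simp add: cong_add_rcancel)
    moreover have "b \<in> {0..<int y}" "b' \<in> {0..<int y}" using that(1,2) B(1) by auto
    ultimately show ?thesis by (blast intro: cong_imp_eq_on_interval)
  qed
  define h where "h = (\<lambda>(a, b). int y * (a - 1) + r b + 1)"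
  have hinj: "s = t" if "s \<in> A \<times> B" "t \<in> A \<times> B" "h s = h t" for s t
  proof -
    obtain a b a' b' where s: "s = (a, b)" "t = (a', b')" by (cases s, cases t)
    have e: "int y * (a - 1) + r b = int y * (a' - 1) + r b'" using that(3) by (simp add: h_def s)
    then have "(int y * (a - 1) + r b) mod int y = (int y * (a' - 1) + r b') mod int y" by simp
    then have "r b = r b'" using rb by simp
    then show ?thesis using e injr that assms s by auto
  qed
  have "card (A \<times> B) = card (h ` (A \<times> B))"
    using hinj by (intro card_image[symmetric]) (simp add: inj_on_def)
  also have "\<dots> \<le> R (g * f) (x * y + 1 - N)"
  proof (rule card_le_R)
    have "N \<le> x * y + 1 \<and> 1 \<le> h (a, b) \<and> h (a, b) \<le> int x * int y + 1 - int N"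
      if "a \<in> A" "b \<in> B" for a b
    proof -
      have a: "1 \<le> a" "a \<le> int x" using A(1) that by auto
      have "int y * (a - 1) \<le> int y * (int x - 1)" using a by (intro mult_left_mono) auto
      moreover have "int y * (a - 1) \<ge> 0" using a by simp
      ultimately have "1 \<le> h (a, b)" "h (a, b) \<le> int x * int y + 1 - int N"
        using r[OF that(2)] by (auto simp: h_def algebra_simps)
      moreover from this have "int N \<le> int (x * y + 1)" by simp
      ultimately show ?thesis by linarith
    qed
    then have "h z \<in> {1..int (x * y + 1 - N)}" if "z \<in> A \<times> B" for z
      using that by (cases z) (fastforce simp: of_nat_diff)
    then show "h ` (A \<times> B) \<subseteq> {1..int (x * y + 1 - N)}" by blast
  next
    fix m
    let ?P = "{(u, v). u \<in> h ` (A \<times> B) \<and> v \<in> h ` (A \<times> B) \<and> u + v = m}"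
    let ?Q = "{(s, t). s \<in> A \<times> B \<and> t \<in> A \<times> B \<and> h s + h t = m}"
    let ?B = "{(s, t). s \<in> B \<and> t \<in> B \<and> [s + t = m - 2 - 2 * c] (mod int y)}"
    \<comment> \<open>once the two residues are chosen, the sum of the two quotients is determined\<close>
    let ?A = "\<lambda>(b, d). {(s, t). s \<in> A \<and> t \<in> A \<and> s + t = (m - 2 - r b - r d) div int y + 2}"
    let ?q = "\<lambda>((a, b), (c, d)). ((b, d), (a, c))"
    have finQ: "finite ?Q" by (intro finite_pairs finite_cartesian_product fin)
    have finA: "finite (?A z)" for z using fin by (cases z) (simp add: finite_pairs)
    have finB: "finite ?B" by (intro finite_pairs fin)
    have "?P \<subseteq> map_prod h h ` ?Q"
    proof
      fix z assume "z \<in> ?P"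
      then obtain s t where "s \<in> A \<times> B" "t \<in> A \<times> B" "h s + h t = m" "z = (h s, h t)" by blast
      then show "z \<in> map_prod h h ` ?Q" by (intro image_eqI[of _ _ "(s, t)"]) simp_all
    qed
    then have "card ?P \<le> card (map_prod h h ` ?Q)" using finQ by (intro card_mono) auto
    also have "\<dots> \<le> card ?Q" using finQ by (intro card_image_le)
    also have "\<dots> \<le> card (Sigma ?B ?A)"
    proof (rule card_inj_on_le[where f = ?q])
      have "inj ?q" by (auto simp: inj_def)
      then show "inj_on ?q ?Q" by (rule inj_on_subset) simp
      show "finite (Sigma ?B ?A)" using finA finB by (intro finite_SigmaI) auto
      have "[b + d = m - 2 - 2 * c] (mod int y) \<and> a + a' = (m - 2 - r b - r d) div int y + 2"
        if "h (a, b) + h (a', d) = m" for a b a' d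
      proof -
        have e: "m - 2 - r b - r d = int y * (a + a' - 2)"
          using that by (simp add: h_def algebra_simps)
        then have "[m - 2 - r b - r d = 0] (mod int y)" by (simp add: cong_0_iff)
        moreover have "[m - 2 - r b - r d = m - 2 - (b + c) - (d + c)] (mod int y)"
          unfolding r_def by (intro cong_diff cong_refl) (auto simp: cong_def)
        ultimately have "[m - 2 - (b + c) - (d + c) = 0] (mod int y)" by (meson cong_sym cong_trans)
        then have "int y dvd (m - 2 - 2 * c) - (b + d)" by (simp add: cong_0_iff algebra_simps)
        then have "[m - 2 - 2 * c = b + d] (mod int y)" by (simp add: cong_iff_dvd_diff)
        then have "[b + d = m - 2 - 2 * c] (mod int y)" by (rule cong_sym)
        with e show ?thesis using assms by simp
      qed
      note * = this
      show "?q ` ?Q \<subseteq> Sigma ?B ?A"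
      proof
        fix z assume "z \<in> ?q ` ?Q"
        then obtain s t where st: "s \<in> A \<times> B" "t \<in> A \<times> B" "h s + h t = m" "z = ?q (s, t)" by blast
        obtain a b a' d where "s = (a, b)" "t = (a', d)" by (cases s, cases t)
        with st *[of a b a' d] show "z \<in> Sigma ?B ?A" by simp
      qed
    qed
    also have "\<dots> = (\<Sum>z\<in>?B. card (?A z))" using finB finA by (intro card_SigmaI) auto
    also have "\<dots> \<le> (\<Sum>z\<in>?B. g)" by (intro sum_mono) (simp add: A(3) split: prod.split)
    also have "\<dots> \<le> g * f" using B(3)[of "m - 2 - 2 * c"] by simp
    finally show "card ?P \<le> g * f" .
  qed
  finally show ?thesis by (simp add: card_cartesian_product A B N_def)
qed

section \<open>An explicit set of integers\<close>

text \<open>The number of \<open>s \<in> U\<close> with \<open>m - s \<in> V\<close>, as an integer so that it can be bounded by integer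
  expressions which may be negative.\<close>

definition reps :: "int set \<Rightarrow> int set \<Rightarrow> int \<Rightarrow> int" where
  "reps U V m = int (card {s \<in> U. m - s \<in> V})"

lemma reps_sym: "reps U V m = reps V U m"
  unfolding reps_def of_nat_eq_iff
  by (rule bij_betw_same_card[of "\<lambda>s. m - s"])
     (rule bij_betw_byWitness[where f' = "\<lambda>s. m - s"], auto)

lemma reps_Un_le: "reps (U \<union> V) W m \<le> reps U W m + reps V W m"
proof -
  have "{s \<in> U \<union> V. m - s \<in> W} = {s \<in> U. m - s \<in> W} \<union> {s \<in> V. m - s \<in> W}" by auto
  then show ?thesis
    using card_Un_le[of "{s \<in> U. m - s \<in> W}" "{s \<in> V. m - s \<in> W}"] by (simp add: reps_def)
qed

lemma reps_interval_le:
  fixes a b c d :: int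
  shows "reps {a..b} {c..d} m \<le> max 0 (b - a + 1)"
    and "reps {a..b} {c..d} m \<le> max 0 (m - a - c + 1)"
    and "reps {a..b} {c..d} m \<le> max 0 (b + d - m + 1)"
proof -
  have "{s \<in> {a..b}. m - s \<in> {c..d}} = {max a (m - d)..min b (m - c)}" by auto
  then have "reps {a..b} {c..d} m = max 0 (min b (m - c) - max a (m - d) + 1)"
    by (simp add: reps_def)
  then show "reps {a..b} {c..d} m \<le> max 0 (b - a + 1)"
    "reps {a..b} {c..d} m \<le> max 0 (m - a - c + 1)"
    "reps {a..b} {c..d} m \<le> max 0 (b + d - m + 1)" by linarith+
qed

text \<open>Only every second element of the surrounding interval is available in a progression of
  difference two, hence the factors two on the left.\<close>

lemma reps_progression_le:
  fixes b c d :: int and h :: nat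
  assumes "V \<subseteq> {c..d}"
  shows "reps ((\<lambda>j. b + 2 * int j) ` {..<h}) V m \<le> int h"
    and "2 * reps ((\<lambda>j. b + 2 * int j) ` {..<h}) V m \<le> max 0 (m - c - b + 2)"
    and "2 * reps ((\<lambda>j. b + 2 * int j) ` {..<h}) V m \<le> max 0 (2 * int h + d + b - m)"
proof -
  let ?B = "(\<lambda>j. b + 2 * int j) ` {..<h}"
  have *: "reps ?B V m \<le> max 0 (v - u + 1)"
    if "\<And>j. j < h \<Longrightarrow> c \<le> m - (b + 2 * int j) \<Longrightarrow> m - (b + 2 * int j) \<le> d \<Longrightarrow> u \<le> int j \<and> int j \<le> v" for u v
  proof -
    have "{s \<in> ?B. m - s \<in> V} \<subseteq> (\<lambda>j. b + 2 * j) ` {u..v}"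
    proof
      fix s assume "s \<in> {s \<in> ?B. m - s \<in> V}"
      then obtain j where "j < h" "s = b + 2 * int j" "m - s \<in> {c..d}" using assms by auto
      then show "s \<in> (\<lambda>j. b + 2 * j) ` {u..v}" using that[of j] by auto
    qed
    then have "card {s \<in> ?B. m - s \<in> V} \<le> card ((\<lambda>j. b + 2 * j) ` {u..v})"
      by (intro card_mono) auto
    also have "\<dots> \<le> card {u..v}" by (rule card_image_le) simp
    finally show ?thesis by (simp add: reps_def)
  qed
  show "reps ?B V m \<le> int h" using *[of 0 "int h - 1"] by auto
  have "reps ?B V m \<le> max 0 ((m - c - b) div 2 - 0 + 1)" by (rule *) presburger
  then show "2 * reps ?B V m \<le> max 0 (m - c - b + 2)" by linarith
  have "reps ?B V m \<le> max 0 ((int h - 1) - (- ((d + b - m) div 2)) + 1)" by (rule *) presburger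
  then show "2 * reps ?B V m \<le> max 0 (2 * int h + d + b - m)" by linarith
qed

lemma card_pairs_eq_reps:
  "int (card {(s, t). s \<in> S \<and> t \<in> S \<and> s + t = m}) = reps S S m"
  unfolding reps_def of_nat_eq_iff
  by (rule bij_betw_same_card[of fst]) (rule bij_betw_byWitness[where f' = "\<lambda>s. (s, m - s)"], auto)

text \<open>With \<open>t = g div 3\<close> and \<open>h = g div 6\<close> the set consists of two intervals of length \<open>t\<close>, a
  progression of \<open>h\<close> elements with difference two, and an interval of length \<open>g\<close>. The number of
  representations of \<open>m\<close> is a sum of ten counts for pairs of blocks. On each of eight ranges of \<open>m\<close>
  all but at most three of them vanish, and the rest add up to at most \<open>g\<close> because
  \<open>3 * t \<le> g\<close> and \<open>2 * h \<le> t\<close>.\<close>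

lemma R_ge_four_blocks:
  "g + 2 * (g div 3) + g div 6 \<le> R g (3 * g - g div 3 + 1)"
proof -
  define t h where "t = g div 3" and "h = g div 6"
  have th: "3 * t \<le> g" unfolding t_def by presburger
  define G T H where "G = int g" and "T = int t" and "H = int h"
  have GTH: "3 * T \<le> G" "2 * H \<le> T" "0 \<le> H"
    unfolding G_def T_def H_def t_def h_def by presburger+
  define A where "A = {1..T}"
  define B where "B = (\<lambda>j. G - T + 1 + 2 * int j) ` {..<h}"
  define C where "C = {G + 1..G + T}"
  define D where "D = {2 * G - T + 2..3 * G - T + 1}"
  note defs = A_def C_def D_def
  define S where "S = A \<union> (B \<union> (C \<union> D))"
  have Bsub: "B \<subseteq> {G - T + 1..G - T - 1 + 2 * H}" by (auto simp: B_def H_def)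
  have fin: "finite A" "finite B" "finite C" "finite D" by (auto simp: defs B_def)
  have "card B = h" unfolding B_def by (subst card_image) (auto simp: inj_on_def)
  moreover have "card A = t" "card C = t" "card D = g" by (auto simp: defs G_def T_def)
  moreover have "C \<inter> D = {}" using GTH by (auto simp: defs)
  moreover have "B \<inter> (C \<union> D) = {}" using GTH Bsub by (fastforce simp: defs)
  moreover have "A \<inter> (B \<union> (C \<union> D)) = {}" using GTH Bsub by (fastforce simp: defs)
  ultimately have "card S = g + 2 * t + h" using fin by (simp add: S_def card_Un_disjoint)
  moreover have "card S \<le> R g (3 * g - t + 1)"
  proof (rule card_le_R)
    have "int (3 * g - t + 1) = 3 * G - T + 1" using th by (simp add: G_def T_def of_nat_diff)
    then show "S \<subseteq> {1..int (3 * g - t + 1)}" using GTH Bsub by (fastforce simp: S_def defs)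
    fix m
    let ?r = "\<lambda>U V. reps U V m"
    have nn: "?r U V \<ge> 0" for U V by (simp add: reps_def)
    have split: "?r U S \<le> ?r A U + ?r B U + ?r C U + ?r D U" for U
      using reps_Un_le[of A "B \<union> (C \<union> D)" U m] reps_Un_le[of B "C \<union> D" U m] reps_Un_le[of C D U m]
        reps_sym[of U S m] by (simp add: S_def)
    have "?r S S \<le> ?r A S + ?r B S + ?r C S + ?r D S" by (rule split)
    then have total: "?r S S \<le> ?r A A + 2 * ?r B A + 2 * ?r A C + 2 * ?r A D + ?r B B + 2 * ?r B C
        + 2 * ?r B D + ?r C C + 2 * ?r C D + ?r D D"
      using split[of A] split[of B] split[of C] split[of D] reps_sym[of A B m] reps_sym[of C A m]
        reps_sym[of D A m] reps_sym[of C B m] reps_sym[of D B m] reps_sym[of D C m]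
        reps_sym[of A S m] reps_sym[of B S m] reps_sym[of C S m] reps_sym[of D S m] by linarith
    note AA = reps_interval_le[of 1 T 1 T m, folded defs]
    note AC = reps_interval_le[of 1 T "G + 1" "G + T" m, folded defs]
    note AD = reps_interval_le[of 1 T "2 * G - T + 2" "3 * G - T + 1" m, folded defs]
    note CC = reps_interval_le[of "G + 1" "G + T" "G + 1" "G + T" m, folded defs]
    note CD = reps_interval_le[of "G + 1" "G + T" "2 * G - T + 2" "3 * G - T + 1" m, folded defs]
    note DD = reps_interval_le[of "2 * G - T + 2" "3 * G - T + 1" "2 * G - T + 2" "3 * G - T + 1" m, folded defs]
    note BA = reps_progression_le[OF order_refl, of "G - T + 1" h 1 T m, folded B_def defs H_def]
    note BC = reps_progression_le[OF order_refl, of "G - T + 1" h "G + 1" "G + T" m, folded B_def defs H_def]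
    note BD = reps_progression_le[OF order_refl, of "G - T + 1" h "2 * G - T + 2" "3 * G - T + 1" m, folded B_def defs H_def]
    note BB = reps_progression_le[OF Bsub, of "G - T + 1" h m, folded B_def H_def]
    consider (c0) "m < G - T + 2"
      | (c1) "G - T + 2 \<le> m \<and> m < 2 * G - 2 * T + 2"
      | (c2) "2 * G - 2 * T + 2 \<le> m \<and> m < 2 * G - T + 2"
      | (c3) "2 * G - T + 2 \<le> m \<and> m < 2 * G + 2"
      | (c4) "2 * G + 2 \<le> m \<and> m < 3 * G - 2 * T + 3"
      | (c5) "3 * G - 2 * T + 3 \<le> m \<and> m < 3 * G - T + 3"
      | (c6) "3 * G - T + 3 \<le> m \<and> m < 4 * G - 2 * T + 4"
      | (c7) "4 * G - 2 * T + 4 \<le> m"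
      by linarith
    then have "?r S S \<le> G"
    proof cases
      case c0
      note c = this
      have "?r B A = 0" using nn[of B A] BA GTH c by linarith
      moreover have "?r A C = 0" using nn[of A C] AC GTH c by linarith
      moreover have "?r A D = 0" using nn[of A D] AD GTH c by linarith
      moreover have "?r B B = 0" using nn[of B B] BB GTH c by linarith
      moreover have "?r B C = 0" using nn[of B C] BC GTH c by linarith
      moreover have "?r B D = 0" using nn[of B D] BD GTH c by linarith
      moreover have "?r C C = 0" using nn[of C C] CC GTH c by linarith
      moreover have "?r C D = 0" using nn[of C D] CD GTH c by linarith
      moreover have "?r D D = 0" using nn[of D D] DD GTH c by linarith
      moreover have "?r A A \<le> T" using AA GTH c by linarith
      ultimately show ?thesis using total GTH c by linarith
    next
      case c1
      note c = this
      have "?r A A = 0" using nn[of A A] AA GTH c by linarith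
      moreover have "?r A D = 0" using nn[of A D] AD GTH c by linarith
      moreover have "?r B B = 0" using nn[of B B] BB GTH c by linarith
      moreover have "?r B C = 0" using nn[of B C] BC GTH c by linarith
      moreover have "?r B D = 0" using nn[of B D] BD GTH c by linarith
      moreover have "?r C C = 0" using nn[of C C] CC GTH c by linarith
      moreover have "?r C D = 0" using nn[of C D] CD GTH c by linarith
      moreover have "?r D D = 0" using nn[of D D] DD GTH c by linarith
      moreover have "?r B A \<le> H" using BA GTH c by linarith
      moreover have "?r A C \<le> T" using AC GTH c by linarith
      ultimately show ?thesis using total GTH c by linarith
    next
      case c2
      note c = this
      have "?r A A = 0" using nn[of A A] AA GTH c by linarith
      moreover have "?r B A = 0" using nn[of B A] BA GTH c by linarith
      moreover have "?r A D = 0" using nn[of A D] AD GTH c by linarith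
      moreover have "?r B C = 0" using nn[of B C] BC GTH c by linarith
      moreover have "?r B D = 0" using nn[of B D] BD GTH c by linarith
      moreover have "?r C C = 0" using nn[of C C] CC GTH c by linarith
      moreover have "?r C D = 0" using nn[of C D] CD GTH c by linarith
      moreover have "?r D D = 0" using nn[of D D] DD GTH c by linarith
      moreover have "?r B B \<le> H" using BB GTH c by linarith
      moreover have "?r A C \<le> T" using AC GTH c by linarith
      ultimately show ?thesis using total GTH c by linarith
    next
      case c3
      note c = this
      have "?r A A = 0" using nn[of A A] AA GTH c by linarith
      moreover have "?r B A = 0" using nn[of B A] BA GTH c by linarith
      moreover have "?r A C = 0" using nn[of A C] AC GTH c by linarith
      moreover have "?r B D = 0" using nn[of B D] BD GTH c by linarith
      moreover have "?r C C = 0" using nn[of C C] CC GTH c by linarith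
      moreover have "?r C D = 0" using nn[of C D] CD GTH c by linarith
      moreover have "?r D D = 0" using nn[of D D] DD GTH c by linarith
      moreover have "2 * ?r B B \<le> max 0 (2 * G - 2 * T + 4 * H - m)" using BB GTH c by linarith
      moreover have "?r B C \<le> H" using BC GTH c by linarith
      moreover have "?r A D \<le> m - 2 * G + T - 2" using AD GTH c by linarith
      ultimately show ?thesis using total GTH c by linarith
    next
      case c4
      note c = this
      have "?r A A = 0" using nn[of A A] AA GTH c by linarith
      moreover have "?r B A = 0" using nn[of B A] BA GTH c by linarith
      moreover have "?r A C = 0" using nn[of A C] AC GTH c by linarith
      moreover have "?r B B = 0" using nn[of B B] BB GTH c by linarith
      moreover have "?r B D = 0" using nn[of B D] BD GTH c by linarith
      moreover have "?r C D = 0" using nn[of C D] CD GTH c by linarith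
      moreover have "?r D D = 0" using nn[of D D] DD GTH c by linarith
      moreover have "2 * ?r B C \<le> max 0 (2 * G + 2 * H + 1 - m)" using BC GTH c by linarith
      moreover have "?r C C \<le> max 0 (m - 2 * G - 1)" using CC GTH c by linarith
      moreover have "?r C C \<le> T" using CC GTH c by linarith
      moreover have "?r A D \<le> T" using AD GTH c by linarith
      ultimately show ?thesis using total GTH c by linarith
    next
      case c5
      note c = this
      have "?r A A = 0" using nn[of A A] AA GTH c by linarith
      moreover have "?r B A = 0" using nn[of B A] BA GTH c by linarith
      moreover have "?r A C = 0" using nn[of A C] AC GTH c by linarith
      moreover have "?r B B = 0" using nn[of B B] BB GTH c by linarith
      moreover have "?r B C = 0" using nn[of B C] BC GTH c by linarith
      moreover have "?r C D = 0" using nn[of C D] CD GTH c by linarith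
      moreover have "?r D D = 0" using nn[of D D] DD GTH c by linarith
      moreover have "2 * ?r B D \<le> m - 3 * G + 2 * T - 1" using BD GTH c by linarith
      moreover have "?r B D \<le> H" using BD GTH c by linarith
      moreover have "?r C C \<le> max 0 (2 * G + 2 * T + 1 - m)" using CC GTH c by linarith
      moreover have "?r A D \<le> T" using AD GTH c by linarith
      ultimately show ?thesis using total GTH c by linarith
    next
      case c6
      note c = this
      have "?r A A = 0" using nn[of A A] AA GTH c by linarith
      moreover have "?r B A = 0" using nn[of B A] BA GTH c by linarith
      moreover have "?r A C = 0" using nn[of A C] AC GTH c by linarith
      moreover have "?r B B = 0" using nn[of B B] BB GTH c by linarith
      moreover have "?r B C = 0" using nn[of B C] BC GTH c by linarith
      moreover have "?r C C = 0" using nn[of C C] CC GTH c by linarith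
      moreover have "?r D D = 0" using nn[of D D] DD GTH c by linarith
      moreover have "?r B D \<le> H" using BD GTH c by linarith
      moreover have "?r C D \<le> T" using CD GTH c by linarith
      moreover have "?r C D \<le> m - 3 * G + T - 2" using CD GTH c by linarith
      moreover have "?r A D \<le> max 0 (3 * G + 2 - m)" using AD GTH c by linarith
      ultimately show ?thesis using total GTH c by linarith
    next
      case c7
      note c = this
      have "?r A A = 0" using nn[of A A] AA GTH c by linarith
      moreover have "?r B A = 0" using nn[of B A] BA GTH c by linarith
      moreover have "?r A C = 0" using nn[of A C] AC GTH c by linarith
      moreover have "?r A D = 0" using nn[of A D] AD GTH c by linarith
      moreover have "?r B B = 0" using nn[of B B] BB GTH c by linarith
      moreover have "?r B C = 0" using nn[of B C] BC GTH c by linarith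
      moreover have "?r C C = 0" using nn[of C C] CC GTH c by linarith
      moreover have "2 * ?r B D \<le> max 0 (4 * G - 2 * T + 2 * H + 2 - m)" using BD GTH c by linarith
      moreover have "?r C D \<le> T" using CD GTH c by linarith
      moreover have "?r C D \<le> max 0 (4 * G + 2 - m)" using CD GTH c by linarith
      moreover have "?r D D \<le> G" using DD GTH c by linarith
      moreover have "?r D D \<le> m - 4 * G + 2 * T - 3" using DD GTH c by linarith
      ultimately show ?thesis using total GTH c by linarith
    qed
    then show "card {(s, t). s \<in> S \<and> t \<in> S \<and> s + t = m} \<le> g"
      using card_pairs_eq_reps[of S m] by (simp add: G_def)
  qed
  ultimately show ?thesis by (simp add: t_def h_def)
qed

section \<open>Ruzsa's construction\<close>

lemma sum_prod_cong_imp: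
  fixes p u u' v v' :: int
  assumes "prime p" "[u + v = u' + v'] (mod p)" "[u * v = u' * v'] (mod p)"
  shows "[u = u'] (mod p) \<or> [u = v'] (mod p)"
proof -
  have "p dvd u * ((u' + v') - (u + v)) - (u' * v' - u * v)"
    using assms(2,3)[THEN cong_sym] unfolding cong_iff_dvd_diff by (rule dvd_diff[OF dvd_mult])
  also have "u * ((u' + v') - (u + v)) - (u' * v' - u * v) = (u - u') * (v' - u)"
    by (simp add: algebra_simps)
  finally have "p dvd u - u' \<or> p dvd v' - u" using assms(1) prime_dvd_mult_iff by blast
  then show ?thesis by (auto simp: cong_iff_dvd_diff dvd_diff_commute)
qed

text \<open>At most two values of \<open>u\<close> modulo \<open>p\<close> are compatible with a given sum and a given product.\<close>

lemma sum_prod_three: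
  fixes p :: int
  assumes "prime p"
    and "[u1 + v1 = u2 + v2] (mod p)" "[u1 + v1 = u3 + v3] (mod p)"
    and "[u1 * v1 = u2 * v2] (mod p)" "[u1 * v1 = u3 * v3] (mod p)"
  shows "[u1 = u2] (mod p) \<or> [u1 = u3] (mod p) \<or> [u2 = u3] (mod p)"
proof (rule ccontr)
  assume n: "\<not> ?thesis"
  then have "[u1 = v2] (mod p)" "[u1 = v3] (mod p)"
    using sum_prod_cong_imp[OF assms(1)] assms by blast+
  then have "[v2 = v3] (mod p)" by (rule cong_trans[OF cong_sym])
  moreover have "[u2 + v2 = u3 + v3] (mod p)" by (rule cong_trans[OF cong_sym[OF assms(2)] assms(3)])
  ultimately have "[u2 + v2 - v2 = u3 + v3 - v3] (mod p)" by (intro cong_diff)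
  then show False using n by simp
qed

text \<open>The element labelled \<open>(i, c)\<close> is the residue that is \<open>i\<close> modulo \<open>p - 1\<close> and \<open>c * w ^ i\<close> modulo
  \<open>p\<close>, where \<open>w\<close> is a primitive root modulo \<open>p\<close>.\<close>

lemma C_ge_ruzsa:
  assumes "prime p" "k < p"
  shows "k * (p - 1) \<le> C (2 * k\<^sup>2) (p\<^sup>2 - p)"
proof -
  have p1: "p > 1" using assms(1) prime_gt_1_nat by blast
  have n: "p\<^sup>2 - p = (p - 1) * p" by (simp add: power2_eq_square diff_mult_distrib)
  obtain w where "residue_primroot p w" using prime_primitive_root_exists[OF p1 assms(1)] by blast
  then have w: "coprime p w" "ord p w = p - 1" using assms(1) by (auto simp: residue_primroot_def totient_prime)
  have w_inj: "i = j" if "[int w ^ i = int w ^ j] (mod int p)" "i < p - 1" "j < p - 1" for i j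
  proof -
    have "[w ^ i = w ^ j] (mod p)" using that(1) by (simp flip: cong_int_iff)
    then have "[i = j] (mod p - 1)" using order_divides_expdiff[of p w i j] w by simp
    then show ?thesis using that(2,3) by (simp add: cong_def)
  qed
  have cop: "coprime (int (p - 1)) (int p)" using p1 by (simp add: coprime_diff_one_left_nat)
  have cop_w: "coprime (int c * int w ^ i) (int p)" "coprime (int c) (int p)" if "c \<in> {1..k}" for c i
  proof -
    have "\<not> p dvd c" using that assms(2) by (auto dest: dvd_imp_le)
    then have "coprime p c" using assms(1) by (intro prime_imp_coprime)
    then show "coprime (int c * int w ^ i) (int p)" "coprime (int c) (int p)"
      using w(1) by (simp_all add: coprime_commute)
  qed
  have "\<exists>z. [z = int i] (mod int (p - 1)) \<and> [z = int c * int w ^ i] (mod int p)" for i c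
    using binary_chinese_remainder_int[OF cop] by auto
  then obtain z where "\<forall>i c. [z i c = int i] (mod int (p - 1)) \<and> [z i c = int c * int w ^ i] (mod int p)"
    by metis
  then have z: "[z i c = int i] (mod int (p - 1))" "[z i c = int c * int w ^ i] (mod int p)" for i c by auto
  define L where "L c = (\<lambda>i. (i, c)) ` {..<p - 1}" for c :: nat
  define f where "f = (\<lambda>(i, c). z i c)"
  have f: "[f (i, c) = int i] (mod int (p - 1))" "[f (i, c) = int c * int w ^ i] (mod int p)" for i c
    using z by (auto simp: f_def)
  have dvd: "int (p - 1) dvd int (p\<^sup>2 - p)" "int p dvd int (p\<^sup>2 - p)" by (simp_all add: n)
  have "card (\<Union>c\<in>{1..k}. L c) \<le> C (2 * (card {1..k})\<^sup>2) (p\<^sup>2 - p)"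
  proof (rule card_UN_le_C[where f = f])
    show "p\<^sup>2 - p > 0" using p1 by (simp add: n)
    show "finite (L c)" for c by (simp add: L_def)
  next
    fix s t assume st: "s \<in> (\<Union>c\<in>{1..k}. L c)" "t \<in> (\<Union>c\<in>{1..k}. L c)" "[f s = f t] (mod int (p\<^sup>2 - p))"
    then obtain i c j d where s: "s = (i, c)" "t = (j, d)" "i < p - 1" "j < p - 1" "c \<in> {1..k}" "d \<in> {1..k}"
      by (auto simp: L_def)
    have e: "[f (i, c) = f (j, d)] (mod int (p - 1))" "[f (i, c) = f (j, d)] (mod int p)"
      using cong_dvd_modulus[OF st(3)] dvd s by auto
    have "[int i = int j] (mod int (p - 1))" by (rule cong_trans[OF cong_sym[OF f(1)] cong_trans[OF e(1) f(1)]])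
    then have "i = j" using s by (simp add: cong_int_iff) (simp add: cong_def)
    have "[int c * int w ^ i = int d * int w ^ i] (mod int p)"
      using cong_trans[OF cong_sym[OF f(2)] cong_trans[OF e(2) f(2)]] \<open>i = j\<close> by simp
    moreover have "coprime (int w ^ i) (int p)" using w(1) by (simp add: coprime_commute)
    ultimately have "[int c = int d] (mod int p)" by (simp add: cong_mult_rcancel)
    then have "c = d" using s(5,6) assms(2) by (simp add: cong_int_iff) (simp add: cong_def)
    with \<open>i = j\<close> s show "s = t" by simp
  next
    fix c d s1 s2 s3 t1 t2 t3
    assume cd: "c \<in> {1..k}" "d \<in> {1..k}" and "{s1, s2, s3} \<subseteq> L c" "{t1, t2, t3} \<subseteq> L d"
      and 2: "[f s1 + f t1 = f s2 + f t2] (mod int (p\<^sup>2 - p))"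
      and 3: "[f s1 + f t1 = f s3 + f t3] (mod int (p\<^sup>2 - p))"
    then obtain i1 i2 i3 j1 j2 j3 where s: "s1 = (i1, c)" "s2 = (i2, c)" "s3 = (i3, c)"
      "t1 = (j1, d)" "t2 = (j2, d)" "t3 = (j3, d)" and lt: "i1 < p - 1" "i2 < p - 1" "i3 < p - 1"
      by (auto simp: L_def)
    let ?u = "\<lambda>i. int c * int w ^ i" and ?v = "\<lambda>j. int d * int w ^ j"
    have sums: "[?u i + ?v j = ?u i' + ?v j'] (mod int p) \<and> [?u i * ?v j = ?u i' * ?v j'] (mod int p)"
      if "[f (i, c) + f (j, d) = f (i', c) + f (j', d)] (mod int (p\<^sup>2 - p))" for i j i' j'
    proof
      have e: "[f (i, c) + f (j, d) = f (i', c) + f (j', d)] (mod int (p - 1))"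
        "[f (i, c) + f (j, d) = f (i', c) + f (j', d)] (mod int p)"
        using cong_dvd_modulus[OF that] dvd by auto
      show "[?u i + ?v j = ?u i' + ?v j'] (mod int p)"
        by (rule cong_trans[OF cong_sym[OF cong_add[OF f(2) f(2)]] cong_trans[OF e(2) cong_add[OF f(2) f(2)]]])
      have "[int i + int j = int i' + int j'] (mod int (p - 1))"
        by (rule cong_trans[OF cong_sym[OF cong_add[OF f(1) f(1)]] cong_trans[OF e(1) cong_add[OF f(1) f(1)]]])
      then have "[i + j = i' + j'] (mod p - 1)" by (simp flip: cong_int_iff)
      then have "[w ^ (i + j) = w ^ (i' + j')] (mod p)" using order_divides_expdiff[of p w "i + j" "i' + j'"] w by simp
      then have "[int w ^ (i + j) = int w ^ (i' + j')] (mod int p)" by (simp flip: cong_int_iff)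
      then have "[int c * int d * int w ^ (i + j) = int c * int d * int w ^ (i' + j')] (mod int p)"
        by (rule cong_scalar_left)
      then show "[?u i * ?v j = ?u i' * ?v j'] (mod int p)" by (simp add: power_add mult_ac)
    qed
    have "[?u i1 = ?u i2] (mod int p) \<or> [?u i1 = ?u i3] (mod int p) \<or> [?u i2 = ?u i3] (mod int p)"
      using sums[of i1 j1 i2 j2] sums[of i1 j1 i3 j3] 2 3 s assms(1)
      by (intro sum_prod_three[of "int p" _ "?v j1" _ "?v j2" _ "?v j3"]) auto
    moreover have "i = i'" if "[?u i = ?u i'] (mod int p)" "i < p - 1" "i' < p - 1" for i i'
      using that cop_w(2)[OF cd(1)] w_inj by (simp add: cong_mult_lcancel)
    ultimately show "s1 = s2 \<or> s1 = s3 \<or> s2 = s3" using lt s by blast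
  qed simp
  moreover have "(\<Union>c\<in>{1..k}. L c) = {..<p - 1} \<times> {1..k}" by (auto simp: L_def)
  ultimately show ?thesis by (simp add: card_cartesian_product mult.commute)
qed

section \<open>A finite field as a quotient of the ring of integer polynomials\<close>

text \<open>An integer matrix that is congruent to the identity modulo \<open>p\<close> has nonzero determinant. Stated
  as injectivity over the complex numbers and proved by elimination, since pivots stay congruent to
  one and the reduced matrix is again congruent to the identity.\<close>

lemma lin_system_unit_mod_p:
  fixes B :: "nat \<Rightarrow> nat \<Rightarrow> int" and v :: "nat \<Rightarrow> complex" and p :: int
  assumes p: "p > 1"
    and B: "\<And>i j. i < n \<Longrightarrow> j < n \<Longrightarrow> [B i j = (if i = j then 1 else 0)] (mod p)"
    and ker: "\<And>i. i < n \<Longrightarrow> (\<Sum>j<n. of_int (B i j) * v j) = 0"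
  shows "i < n \<Longrightarrow> v i = 0"
  using B ker
proof (induction n arbitrary: B i)
  case (Suc n)
  have Bnn: "[B n n = 1] (mod p)" using Suc.prems(2)[of n n] by simp
  have v0: "v i = 0" if "i < n" for i
  proof (rule Suc.IH[OF that])
    fix i j assume ij: "i < n" "j < n"
    have "[B n n * B i j - B i n * B n j = 1 * (if i = j then 1 else 0) - 0 * 0] (mod p)"
      using ij Suc.prems(2)[of i j] Suc.prems(2)[of i n] Suc.prems(2)[of n j]
      by (intro cong_diff cong_mult Bnn) auto
    then show "[B n n * B i j - B i n * B n j = (if i = j then 1 else 0)] (mod p)" by simp
  next
    fix i assume i: "i < n"
    have "(\<Sum>j<n. of_int (B n n * B i j - B i n * B n j) * v j) =
        of_int (B n n) * (\<Sum>j<Suc n. of_int (B i j) * v j) - of_int (B i n) * (\<Sum>j<Suc n. of_int (B n j) * v j)"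
      by (simp add: sum_distrib_left sum_subtractf algebra_simps)
    also have "\<dots> = 0" using Suc.prems(3)[of i] Suc.prems(3)[of n] i by simp
    finally show "(\<Sum>j<n. of_int (B n n * B i j - B i n * B n j) * v j) = 0" .
  qed
  have "B n n \<noteq> 0"
  proof
    assume "B n n = 0"
    then have "p dvd 1" using Bnn by (metis cong_0_iff cong_sym)
    then show False using p by simp
  qed
  moreover have "of_int (B n n) * v n = 0" using Suc.prems(3)[of n] v0 by simp
  ultimately have "v n = 0" by simp
  with v0 Suc.prems(1) show ?case by (cases "i = n") auto
qed simp

text \<open>A prime ideal of a commutative ring, and the calculus of congruence modulo that ideal.\<close>

locale prime_ideal =
  fixes P :: "'a::comm_ring_1 set"
  assumes add_mem: "a \<in> P \<Longrightarrow> b \<in> P \<Longrightarrow> a + b \<in> P"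
    and mult_mem: "a \<in> P \<Longrightarrow> r * a \<in> P"
    and zero_mem: "0 \<in> P"
    and one_nmem: "1 \<notin> P"
    and prime_mem: "a * b \<in> P \<Longrightarrow> a \<in> P \<or> b \<in> P"
begin

lemma mult_mem2: "a \<in> P \<Longrightarrow> a * r \<in> P"
  using mult_mem[of a r] by (simp add: mult.commute)

lemma uminus_mem: "a \<in> P \<Longrightarrow> - a \<in> P"
  using mult_mem[of a "-1"] by simp

lemma diff_mem: "a \<in> P \<Longrightarrow> b \<in> P \<Longrightarrow> a - b \<in> P"
  using add_mem[of a "-b"] uminus_mem by simp

lemma prod_mem: "finite A \<Longrightarrow> (\<Prod>i\<in>A. f i) \<in> P \<Longrightarrow> \<exists>i\<in>A. f i \<in> P"
  by (induction A rule: finite_induct) (use one_nmem prime_mem in auto)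

lemma sum_mem: "(\<And>i. i \<in> A \<Longrightarrow> f i \<in> P) \<Longrightarrow> (\<Sum>i\<in>A. f i) \<in> P"
  by (induction A rule: infinite_finite_induct) (auto intro: zero_mem add_mem)

lemma pow_mem: "a ^ n \<in> P \<Longrightarrow> a \<in> P"
  by (induction n) (use one_nmem prime_mem in auto)

text \<open>Congruence modulo \<open>P\<close>, which plays the role of equality in the quotient ring.\<close>

definition eqv :: "'a \<Rightarrow> 'a \<Rightarrow> bool" (infix \<open>\<approx>\<close> 50) where
  "a \<approx> b \<longleftrightarrow> a - b \<in> P"

lemma eqv_refl [simp, intro]: "a \<approx> a" by (simp add: eqv_def zero_mem)

lemma eqv_sym: "a \<approx> b \<Longrightarrow> b \<approx> a"
  unfolding eqv_def using uminus_mem[of "a - b"] by simp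

lemma eqv_trans [trans]: "a \<approx> b \<Longrightarrow> b \<approx> c \<Longrightarrow> a \<approx> c"
  unfolding eqv_def using add_mem[of "a - b" "b - c"] by simp

lemma eqv_0 [simp]: "a \<approx> 0 \<longleftrightarrow> a \<in> P" by (simp add: eqv_def)

lemma eqv_mem: "a \<approx> b \<Longrightarrow> a \<in> P \<longleftrightarrow> b \<in> P"
  by (metis eqv_0 eqv_sym eqv_trans)

lemma eqv_add: "a \<approx> b \<Longrightarrow> c \<approx> d \<Longrightarrow> a + c \<approx> b + d"
  unfolding eqv_def using add_mem[of "a - b" "c - d"] by (simp add: algebra_simps)

lemma eqv_minus: "a \<approx> b \<Longrightarrow> - a \<approx> - b"
  unfolding eqv_def using uminus_mem[of "a - b"] by (simp add: algebra_simps)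

lemma eqv_diff: "a \<approx> b \<Longrightarrow> c \<approx> d \<Longrightarrow> a - c \<approx> b - d"
  using eqv_add[of a b "-c" "-d"] eqv_minus by simp

lemma eqv_mult: "a \<approx> b \<Longrightarrow> c \<approx> d \<Longrightarrow> a * c \<approx> b * d"
  unfolding eqv_def using add_mem[OF mult_mem[of "a - b" c] mult_mem[of "c - d" b]]
  by (simp add: algebra_simps)

lemma eqv_power: "a \<approx> b \<Longrightarrow> a ^ n \<approx> b ^ n"
  by (induction n) (auto intro: eqv_mult)

lemma eqv_cancel: "c * a \<approx> c * b \<Longrightarrow> c \<notin> P \<Longrightarrow> a \<approx> b"
  unfolding eqv_def using prime_mem[of c "a - b"] by (auto simp: algebra_simps)

end

text \<open>Krull: a proper ideal lies in a maximal ideal, and maximal ideals are prime.\<close>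

lemma exists_prime_ideal:
  fixes I :: "'a::comm_ring_1 set"
  assumes I: "\<And>a b. a \<in> I \<Longrightarrow> b \<in> I \<Longrightarrow> a + b \<in> I" "\<And>a r. a \<in> I \<Longrightarrow> r * a \<in> I" "0 \<in> I" "1 \<notin> I"
  obtains P where "prime_ideal P" "I \<subseteq> P"
proof -
  define ideal where "ideal J \<longleftrightarrow> (\<forall>a\<in>J. \<forall>b\<in>J. a + b \<in> J) \<and> (\<forall>a\<in>J. \<forall>r. r * a \<in> J) \<and> I \<subseteq> J \<and> 1 \<notin> J"
    for J :: "'a set"
  have "\<exists>P\<in>Collect ideal. \<forall>J\<in>Collect ideal. P \<subseteq> J \<longrightarrow> J = P"
  proof (rule subset_Zorn_nonempty)
    have "ideal I" using I by (auto simp: ideal_def)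
    then show "Collect ideal \<noteq> {}" by auto
    fix \<C> assume C: "\<C> \<noteq> {}" "subset.chain (Collect ideal) \<C>"
    have sub: "\<And>J. J \<in> \<C> \<Longrightarrow> ideal J" and lin: "\<And>J J'. J \<in> \<C> \<Longrightarrow> J' \<in> \<C> \<Longrightarrow> J \<subseteq> J' \<or> J' \<subseteq> J"
      using C(2) by (auto simp: subset_chain_def)
    have "a + b \<in> \<Union>\<C>" if ab: "a \<in> \<Union>\<C>" "b \<in> \<Union>\<C>" for a b
    proof -
      obtain J J' where J: "J \<in> \<C>" "a \<in> J" "J' \<in> \<C>" "b \<in> J'" using ab by auto
      with lin[of J J'] consider "a \<in> J'" | "b \<in> J" by blast
      then have "a + b \<in> J \<or> a + b \<in> J'"
        using J sub[of J] sub[of J'] by cases (auto simp: ideal_def)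
      then show ?thesis using J by blast
    qed
    moreover have "r * a \<in> \<Union>\<C>" if "a \<in> \<Union>\<C>" for a r
      using that sub by (fastforce simp: ideal_def)
    moreover have "I \<subseteq> \<Union>\<C>" "1 \<notin> \<Union>\<C>" using C(1) sub by (auto simp: ideal_def)
    ultimately show "\<Union>\<C> \<in> Collect ideal" by (simp add: ideal_def)
  qed
  then obtain P where P: "ideal P" and max: "\<And>J. ideal J \<Longrightarrow> P \<subseteq> J \<Longrightarrow> J = P" by blast
  have "prime_ideal P"
  proof
    show "a + b \<in> P" if "a \<in> P" "b \<in> P" for a b using P that by (auto simp: ideal_def)
    show rm: "r * a \<in> P" if "a \<in> P" for a r using P that by (auto simp: ideal_def)
    show "0 \<in> P" "1 \<notin> P" using P I(3) by (auto simp: ideal_def)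
    fix a b assume ab: "a * b \<in> P"
    show "a \<in> P \<or> b \<in> P"
    proof (rule ccontr)
      assume n: "\<not> (a \<in> P \<or> b \<in> P)"
      \<comment> \<open>the ideal generated by \<open>P\<close> and \<open>a\<close>, which is everything by maximality\<close>
      define J where "J = {m + a * r | m r. m \<in> P}"
      have PJ: "P \<subseteq> J" unfolding J_def by (force intro: exI[of _ 0])
      have aJ: "a \<in> J" unfolding J_def using \<open>0 \<in> P\<close> by (force intro: exI[of _ 0] exI[of _ 1])
      have "1 \<in> J"
      proof (rule ccontr)
        assume "1 \<notin> J"
        have "u + v \<in> J" if uv: "u \<in> J" "v \<in> J" for u v
        proof -
          obtain m r m' r' where "u = m + a * r" "v = m' + a * r'" "m \<in> P" "m' \<in> P"
            using uv by (auto simp: J_def)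
          then have "u + v = (m + m') + a * (r + r')" "m + m' \<in> P"
            using P by (auto simp: ideal_def algebra_simps)
          then show ?thesis unfolding J_def by blast
        qed
        moreover have "s * u \<in> J" if u: "u \<in> J" for s u
        proof -
          obtain m r where "u = m + a * r" "m \<in> P" using u by (auto simp: J_def)
          then have "s * u = s * m + a * (s * r)" "s * m \<in> P" using rm by (auto simp: algebra_simps)
          then show ?thesis unfolding J_def by blast
        qed
        ultimately have "ideal J" using PJ P \<open>1 \<notin> J\<close> by (auto simp: ideal_def)
        then show False using max[of J] PJ aJ n by auto
      qed
      then obtain m r where mr: "1 = m + a * r" "m \<in> P" by (auto simp: J_def)
      have "b = b * (m + a * r)" using mr(1) by simp
      also have "\<dots> = b * m + r * (a * b)" by (simp add: algebra_simps)
      also have "\<dots> \<in> P" using rm[OF mr(2), of b] rm[OF ab, of r] P by (auto simp: ideal_def)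
      finally show False using n by simp
    qed
  qed
  moreover have "I \<subseteq> P" using P by (simp add: ideal_def)
  ultimately show ?thesis using that by blast
qed

context prime_ideal
begin

lemma frobenius_add:
  fixes p :: nat
  assumes "prime p" "of_nat p \<in> P"
  shows "(a + b) ^ p \<approx> a ^ p + b ^ p"
proof -
  have p2: "p \<ge> 2" using assms(1) prime_ge_2_nat by blast
  let ?t = "\<lambda>k. of_nat (p choose k) * a ^ k * b ^ (p - k)"
  have "{..p} = insert 0 (insert p {0<..<p})" using p2 by auto
  then have "(a + b) ^ p = a ^ p + b ^ p + (\<Sum>k\<in>{0<..<p}. ?t k)"
    using p2 by (simp add: binomial_ring algebra_simps)
  moreover have "(\<Sum>k\<in>{0<..<p}. ?t k) \<in> P"
  proof -
    have "?t k \<in> P" if k: "k \<in> {0<..<p}" for k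
    proof -
      have "p dvd (p choose k)" using k assms(1) by (intro dvd_choose_prime) auto
      then obtain r where "p choose k = p * r" by auto
      then have "?t k = of_nat p * (of_nat r * a ^ k * b ^ (p - k))" by (simp add: algebra_simps)
      then show ?thesis using mult_mem2[OF assms(2)] by simp
    qed
    then show ?thesis by (rule sum_mem)
  qed
  ultimately show ?thesis by (simp add: eqv_def)
qed

lemma frobenius_power_add:
  fixes p :: nat
  assumes "prime p" "of_nat p \<in> P"
  shows "(a + b) ^ (p ^ e) \<approx> a ^ (p ^ e) + b ^ (p ^ e)"
proof (induction e)
  case (Suc e)
  have "(a + b) ^ (p ^ Suc e) = ((a + b) ^ (p ^ e)) ^ p" by (simp only: power_Suc2 power_mult)
  also have "\<dots> \<approx> (a ^ (p ^ e) + b ^ (p ^ e)) ^ p" by (intro eqv_power Suc)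
  also have "\<dots> \<approx> (a ^ (p ^ e)) ^ p + (b ^ (p ^ e)) ^ p" by (intro frobenius_add assms)
  finally show ?case by (simp only: power_Suc2 power_mult)
qed simp

text \<open>The fixed points of \<open>a \<mapsto> a ^ (p ^ e)\<close> modulo \<open>P\<close> contain the integers and are closed under
  addition and negation; closure under multiplication is clear.\<close>

lemma frobenius_fixed_add:
  fixes p :: nat
  assumes "prime p" "of_nat p \<in> P" "a ^ (p ^ e) \<approx> a" "b ^ (p ^ e) \<approx> b"
  shows "(a + b) ^ (p ^ e) \<approx> a + b"
  using frobenius_power_add[OF assms(1,2)] eqv_add[OF assms(3,4)] by (rule eqv_trans)

lemma frobenius_fixed_uminus:
  fixes p :: nat
  assumes "prime p" "of_nat p \<in> P" "a ^ (p ^ e) \<approx> a"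
  shows "(- a) ^ (p ^ e) \<approx> - a"
proof -
  have "0 ^ (p ^ e) \<approx> a ^ (p ^ e) + (- a) ^ (p ^ e)"
    using frobenius_power_add[OF assms(1,2), of a "- a" e] by simp
  moreover have "p ^ e > 0" using assms(1) prime_gt_0_nat by simp
  ultimately have "a ^ (p ^ e) + (- a) ^ (p ^ e) \<approx> 0" by (metis eqv_sym zero_power)
  then have "a ^ (p ^ e) + (- a) ^ (p ^ e) - a ^ (p ^ e) \<approx> 0 - a"
    using assms(3) by (rule eqv_diff)
  then show ?thesis by simp
qed

lemma frobenius_fixed_of_int:
  fixes p :: nat
  assumes "prime p" "of_nat p \<in> P"
  shows "of_int c ^ (p ^ e) \<approx> of_int c"
proof -
  have pe: "p ^ e > 0" using assms(1) prime_gt_0_nat by simp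
  have nat: "of_nat n ^ (p ^ e) \<approx> of_nat n" for n
  proof (induction n)
    case (Suc n)
    then show ?case using frobenius_fixed_add[OF assms, of 1 e "of_nat n"] by simp
  qed (use pe in \<open>simp add: zero_power zero_mem\<close>)
  show ?thesis
  proof (cases c)
    case (nonneg n)
    then show ?thesis using nat[of n] by simp
  next
    case (neg n)
    then show ?thesis using frobenius_fixed_uminus[OF assms nat[of "Suc n"]] by (simp del: of_nat_Suc)
  qed
qed

end

lemma prod_roots_unity:
  fixes w :: complex
  assumes "n > 0"
  shows "(\<Prod>i<n. w - cis (2 * pi / n) ^ i) = w ^ n - 1"
proof -
  let ?z = "\<lambda>i. cis (2 * pi / n) ^ i"
  have z: "?z i = cis (2 * pi * real i / real n)" for i by (simp add: DeMoivre mult.commute)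
  have bij: "bij_betw ?z {..<n} {z. z ^ n = 1}"
    unfolding z using assms by (rule bij_betw_roots_unity)
  define A where "A = (\<Prod>i<n. [:- ?z i, 1:])"
  define D where "D = A - (Polynomial.monom 1 n - 1)"
  have "degree A = n" unfolding A_def by (simp add: degree_prod_sum_eq)
  moreover have "lead_coeff A = 1" unfolding A_def lead_coeff_prod by simp
  ultimately have "degree A = n" "poly.coeff A n = 1" by auto
  have "D = 0"
  proof (rule ccontr)
    assume "D \<noteq> 0"
    have "degree (Polynomial.monom 1 n - 1 :: complex poly) \<le> n"
      by (intro degree_diff_le) (auto simp: degree_monom_eq)
    then have "degree D \<le> n" unfolding D_def using \<open>degree A = n\<close> by (intro degree_diff_le[of A]) auto
    moreover have "poly.coeff D n = 0" using \<open>poly.coeff A n = 1\<close> assms by (simp add: D_def)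
    ultimately have "degree D < n"
      using \<open>D \<noteq> 0\<close> by (metis le_neq_implies_less leading_coeff_0_iff)
    moreover have "{z. z ^ n = 1} \<subseteq> {z. poly D z = 0}"
    proof
      fix u :: complex assume u: "u \<in> {z. z ^ n = 1}"
      also have "{z. z ^ n = 1} = ?z ` {..<n}" using bij by (simp add: bij_betw_def)
      finally have "u \<in> ?z ` {..<n}" .
      with u obtain i where i: "i < n" "u = ?z i" "u ^ n = 1" by blast
      then have "poly A u = 0" unfolding A_def by (auto simp: poly_prod)
      then show "u \<in> {z. poly D z = 0}" using i by (simp add: D_def poly_monom)
    qed
    then have "card {z::complex. z ^ n = 1} \<le> card {z. poly D z = 0}"
      using \<open>D \<noteq> 0\<close> by (intro card_mono poly_roots_finite)
    ultimately show False
      using card_poly_roots_bound[OF \<open>D \<noteq> 0\<close>] bij_betw_same_card[OF bij] by simp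
  qed
  then have "poly A w = poly (Polynomial.monom 1 n - 1) w" by (simp add: D_def)
  then show ?thesis by (simp add: A_def poly_prod poly_monom)
qed

text \<open>The value at one of the quotient of \<open>X ^ n - 1\<close> by \<open>X - 1\<close>. It shows that \<open>\<zeta> ^ i - 1\<close> divides
  \<open>n\<close>, so that the powers of \<open>\<zeta>\<close> remain distinct modulo every prime ideal that does not contain
  \<open>n\<close>.\<close>

lemma prod_one_minus_roots_unity:
  assumes "n > 0"
  shows "(\<Prod>i\<in>{0<..<n}. 1 - cis (2 * pi / n) ^ i) = of_nat n"
proof -
  let ?z = "\<lambda>i. cis (2 * pi / n) ^ i"
  define A where "A = (\<Prod>i\<in>{0<..<n}. [:- ?z i, 1:])"
  have split: "{..<n} = insert 0 {0<..<n}" using assms by auto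
  have "poly ([:- 1, 1:] * A) w = poly ([:- 1, 1:] * (\<Sum>i<n. Polynomial.monom 1 i)) w" for w
  proof -
    have "poly ([:- 1, 1:] * A) w = w ^ n - 1"
      using prod_roots_unity[OF assms, of w] by (simp add: split A_def poly_prod algebra_simps)
    also have "\<dots> = (w - 1) * (\<Sum>i<n. w ^ i)" by (rule power_diff_1_eq)
    finally show ?thesis by (simp add: poly_sum poly_monom algebra_simps)
  qed
  then have "[:- 1, 1:] * A = [:- 1, 1:] * (\<Sum>i<n. Polynomial.monom 1 i)" by (simp add: poly_eq_poly_eq_iff[symmetric] fun_eq_iff)
  then have "A = (\<Sum>i<n. Polynomial.monom 1 i)" by (subst (asm) mult_cancel_left) simp
  then have "poly A 1 = of_nat n" by (simp add: poly_sum poly_monom)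
  then show ?thesis by (simp add: A_def poly_prod)
qed

text \<open>Evaluation of an integer polynomial at a complex number.\<close>

definition ev :: "complex \<Rightarrow> int poly \<Rightarrow> complex" where
  "ev z f = poly (map_poly of_int f) z"

lemma ev_0 [simp]: "ev z 0 = 0"
  and ev_pCons: "ev z (pCons a f) = of_int a + z * ev z f"
  by (simp_all add: ev_def map_poly_pCons)

lemma ev_add: "ev z (f + g) = ev z f + ev z g"
proof -
  have "map_poly complex_of_int (f + g) = map_poly of_int f + map_poly of_int g"
    by (rule poly_eqI) (simp add: coeff_map_poly)
  then show ?thesis by (simp add: ev_def)
qed

lemma ev_smult: "ev z (smult a f) = of_int a * ev z f"
proof -
  have "map_poly complex_of_int (smult a f) = smult (of_int a) (map_poly of_int f)"
    by (rule poly_eqI) (simp add: coeff_map_poly)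
  then show ?thesis by (simp add: ev_def)
qed

lemma ev_mult: "ev z (f * g) = ev z f * ev z g"
proof (induction f)
  case (pCons a f)
  have "pCons a f * g = smult a g + pCons 0 (f * g)" by simp
  with pCons show ?case by (simp add: ev_add ev_smult ev_pCons algebra_simps)
qed simp

lemma ev_of_int [simp]: "ev z (of_int a) = of_int a"
  by (simp add: of_int_poly ev_pCons)

lemma ev_1 [simp]: "ev z 1 = 1"
  using ev_of_int[of z 1] by simp

lemma ev_diff: "ev z (f - g) = ev z f - ev z g"
  using ev_add[of z "f - g" g] by simp

lemma ev_power: "ev z (f ^ n) = ev z f ^ n"
  by (induction n) (simp_all add: ev_mult)

lemma ev_prod: "finite A \<Longrightarrow> ev z (\<Prod>i\<in>A. f i) = (\<Prod>i\<in>A. ev z (f i))"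
  by (induction A rule: finite_induct) (simp_all add: ev_mult)

lemma ev_X [simp]: "ev z [:0, 1:] = z"
  by (simp add: ev_pCons)

lemma ev_root_unity_span:
  assumes "n > 0" "z ^ n = 1"
  shows "\<exists>a. ev z f = (\<Sum>j<n. of_int (a j) * z ^ j)"
proof (induction f)
  case 0
  show ?case by (intro exI[of _ "\<lambda>_. 0"]) simp
next
  case (pCons c f)
  then obtain a where a: "ev z f = (\<Sum>j<n. of_int (a j) * z ^ j)" by blast
  obtain m where n: "n = Suc m" using assms(1) by (cases n) auto
  have "z * ev z f = (\<Sum>j<m. of_int (a j) * z ^ Suc j) + of_int (a m) * z ^ n"
    unfolding a n by (simp add: algebra_simps sum_distrib_left)
  then have "ev z (pCons c f) = of_int (c + a m) + (\<Sum>j<m. of_int (a j) * z ^ Suc j)"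
    using assms(2) by (simp add: ev_pCons)
  also have "\<dots> = (\<Sum>j<n. of_int (case j of 0 \<Rightarrow> c + a m | Suc i \<Rightarrow> a i) * z ^ j)"
    unfolding n by (subst sum.lessThan_Suc_shift) simp
  finally show ?case by blast
qed

text \<open>For a root of unity \<open>z\<close>, the integer \<open>p\<close> is not invertible in \<open>\<int>[z]\<close>: otherwise every power
  \<open>z ^ i\<close> with \<open>i < n\<close> would be \<open>p\<close> times an integer combination of these powers, and the vector of
  powers would lie in the kernel of a matrix congruent to the identity modulo \<open>p\<close>.\<close>

lemma one_not_p_multiple:
  assumes "n > 0" "z ^ n = 1" "p > (1::int)"
  shows "1 \<noteq> of_int p * ev z g"
proof
  assume 1: "1 = of_int p * ev z g"
  have "\<exists>a. ev z ([:0, 1:] ^ i * g) = (\<Sum>j<n. of_int (a j) * z ^ j)" for i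
    using assms by (intro ev_root_unity_span)
  then obtain b where b: "\<And>i. ev z ([:0, 1:] ^ i * g) = (\<Sum>j<n. of_int (b i j) * z ^ j)" by metis
  define B where "B i j = (if i = j then 1 else 0) - p * b i j" for i j
  have "z ^ 0 = 0"
  proof (rule lin_system_unit_mod_p[where B = B and p = p and n = n and v = "\<lambda>j. z ^ j"])
    fix i j assume "i < n"
    show "[B i j = (if i = j then 1 else 0)] (mod p)" by (simp add: B_def cong_iff_dvd_diff)
    have "(\<Sum>j<n. of_int (B i j) * z ^ j) =
        (\<Sum>j<n. if i = j then z ^ j else 0) - of_int p * (\<Sum>j<n. of_int (b i j) * z ^ j)"
      unfolding B_def sum_distrib_left sum_subtractf[symmetric]
      by (intro sum.cong refl) (simp add: algebra_simps)
    also have "\<dots> = z ^ i - of_int p * (z ^ i * ev z g)"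
      using \<open>i < n\<close> by (simp add: ev_mult ev_power flip: b)
    also have "\<dots> = z ^ i * (1 - of_int p * ev z g)" by (simp add: algebra_simps)
    also have "\<dots> = 0" using 1 by simp
    finally show "(\<Sum>j<n. of_int (B i j) * z ^ j) = 0" .
  qed (use assms in auto)
  then show False by simp
qed

text \<open>The quotient by \<open>P\<close> is the field with \<open>Q = p ^ e\<close> elements, and the variable \<open>[:0, 1:]\<close> generates
  its multiplicative group.\<close>

lemma exists_finite_field:
  fixes p e :: nat
  assumes "prime p" and Q: "Q = p ^ e" and "Q > 1"
  obtains P :: "int poly set" where "prime_ideal P" "of_nat p \<in> P" "[:0, 1:] ^ (Q - 1) - 1 \<in> P"
    "\<And>f. f ^ Q - f \<in> P"
    "\<And>i. 0 < i \<Longrightarrow> i < Q - 1 \<Longrightarrow> [:0, 1:] ^ i - 1 \<notin> P"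
    "\<And>f. f \<notin> P \<Longrightarrow> \<exists>i<Q - 1. f - [:0, 1:] ^ i \<in> P"
proof -
  define n where "n = Q - 1"
  define z where "z = cis (2 * pi / n)"
  have n0: "n > 0" using assms by (simp add: n_def)
  have zn: "z ^ n = 1" using n0 by (simp add: z_def DeMoivre)
  define I where "I = {f. \<exists>g. ev z f = of_int (int p) * ev z g}"
  obtain P where P: "prime_ideal P" "I \<subseteq> P"
  proof (rule exists_prime_ideal[of I])
    show "a + b \<in> I" if "a \<in> I" "b \<in> I" for a b
    proof -
      from that obtain g h where "ev z a = of_int (int p) * ev z g" "ev z b = of_int (int p) * ev z h"
        by (auto simp: I_def)
      then show ?thesis by (auto simp: I_def ev_add algebra_simps intro!: exI[of _ "g + h"])
    qed
    show "r * a \<in> I" if "a \<in> I" for a r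
    proof -
      from that obtain g where "ev z a = of_int (int p) * ev z g" by (auto simp: I_def)
      then show ?thesis by (auto simp: I_def ev_mult algebra_simps intro!: exI[of _ "r * g"])
    qed
    show "0 \<in> I" by (auto simp: I_def intro!: exI[of _ 0])
    show "1 \<notin> I"
      using one_not_p_multiple[OF n0 zn, of "int p"] prime_gt_1_nat[OF assms(1)] by (auto simp: I_def)
  qed
  then interpret prime_ideal P by simp
  \<comment> \<open>identities between powers of the root of unity become congruences modulo \<open>P\<close>\<close>
  have ker: "f \<in> P" if "ev z f = 0" for f
    using that P(2) by (auto simp: I_def intro!: exI[of _ 0])
  have "(of_nat p :: int poly) = of_int (int p)" by simp
  then have pP: "of_nat p \<in> P" using P(2) by (auto simp: I_def intro!: exI[of _ 1] simp del: of_int_of_nat_eq)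
  have "p dvd Q" using assms by (cases e) auto
  then obtain r where r: "Q = p * r" by auto
  have QP: "of_nat Q \<in> P" using mult_mem2[OF pP, of "of_nat r"] by (simp add: r)
  have XnP: "[:0, 1:] ^ n - 1 \<in> P" by (rule ker) (simp add: ev_diff ev_power zn)
  have XQ: "eqv ([:0, 1:] ^ Q) [:0, 1:]"
  proof -
    have "[:0, 1:] ^ Q - [:0, 1:] = [:0, 1:] * ([:0, 1:] ^ n - (1 :: int poly))"
      using assms(3) by (simp add: n_def algebra_simps flip: power_Suc)
    then show ?thesis unfolding eqv_def using mult_mem[OF XnP] by metis
  qed
  show ?thesis
  proof (rule that[of P])
    show "f ^ Q - f \<in> P" for f
      unfolding eqv_def[symmetric]
    proof (induction f)
      case (pCons a f)
      have "pCons a f = of_int a + [:0, 1:] * f" by (simp add: of_int_poly)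
      moreover have "eqv (([:0, 1:] * f) ^ Q) ([:0, 1:] * f)"
        unfolding power_mult_distrib by (intro eqv_mult XQ pCons)
      ultimately show ?case
        using frobenius_fixed_add[OF assms(1) pP frobenius_fixed_of_int[OF assms(1) pP]] by (simp only: Q)
    qed (use assms(3) in \<open>simp add: zero_power zero_mem\<close>)
    show "[:0, 1:] ^ i - 1 \<notin> P" if i: "0 < i" "i < Q - 1" for i
    proof
      assume iP: "[:0, 1:] ^ i - 1 \<in> P"
      have "(\<Prod>j\<in>{0<..<n}. 1 - [:0, 1:] ^ j) - of_nat n \<in> P"
      proof (rule ker)
        have "ev z (of_nat n) = of_nat n" using ev_of_int[of z "int n"] by simp
        then show "ev z ((\<Prod>j\<in>{0<..<n}. 1 - [:0, 1:] ^ j) - of_nat n) = 0"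
          using prod_one_minus_roots_unity[OF n0] by (simp add: ev_diff ev_prod ev_power z_def)
      qed
      moreover have "(\<Prod>j\<in>{0<..<n}. 1 - [:0, 1:] ^ j) \<in> P"
      proof -
        have "(\<Prod>j\<in>{0<..<n}. 1 - [:0, 1:] ^ j) =
            (1 - [:0, 1:] ^ i) * (\<Prod>j\<in>{0<..<n} - {i}. 1 - [:0, 1:] ^ j :: int poly)"
          using i by (intro prod.remove) (auto simp: n_def)
        moreover have "1 - [:0, 1:] ^ i \<in> P" using uminus_mem[OF iP] by simp
        ultimately show ?thesis by (metis mult_mem2)
      qed
      ultimately have "of_nat n \<in> P" using diff_mem by fastforce
      then have "of_nat Q - of_nat n \<in> P" by (intro diff_mem QP)
      moreover have "of_nat Q - of_nat n = (1 :: int poly)" using assms(3) by (simp add: n_def of_nat_diff)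
      ultimately show False using one_nmem by simp
    qed
    show "\<exists>i<Q - 1. f - [:0, 1:] ^ i \<in> P" if f: "f \<notin> P" for f
    proof -
      have "(\<Prod>i<n. f - [:0, 1:] ^ i) - (f ^ n - 1) \<in> P"
        using prod_roots_unity[OF n0, of "ev z f"]
        by (intro ker) (simp add: ev_diff ev_prod ev_power z_def)
      moreover have "f ^ n - 1 \<in> P"
      proof -
        have "f * (f ^ n - 1) = f ^ Q - f"
          using assms(3) by (simp add: n_def algebra_simps flip: power_Suc)
        then have "f * (f ^ n - 1) \<in> P" using \<open>f ^ Q - f \<in> P\<close> by simp
        then show ?thesis using prime_mem f by blast
      qed
      ultimately have "(\<Prod>i<n. f - [:0, 1:] ^ i) \<in> P" using add_mem by fastforce
      then show ?thesis using prod_mem[of "{..<n}"] by (auto simp: n_def)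
    qed
  qed (use P pP XnP in \<open>auto simp: n_def\<close>)
qed

section \<open>Subfields and discrete logarithms\<close>

text \<open>A prime ideal \<open>P\<close> whose quotient is a field with \<open>Q\<close> elements of characteristic \<open>p\<close>, together
  with an element \<open>X\<close> that generates the multiplicative group of the quotient.\<close>

locale finite_field_model = prime_ideal P for P :: "'a::comm_ring_1 set" +
  fixes p Q :: nat and X :: 'a
  assumes prime_p: "prime p" and p_mem: "of_nat p \<in> P" and Q_gt_1: "Q > 1"
    and X_order: "X ^ (Q - 1) \<approx> 1"
    and fixed_Q: "f ^ Q \<approx> f"
    and X_primitive: "0 < i \<Longrightarrow> i < Q - 1 \<Longrightarrow> \<not> X ^ i \<approx> 1"
    and exists_log: "f \<notin> P \<Longrightarrow> \<exists>i<Q - 1. f \<approx> X ^ i"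
begin

text \<open>The order of the multiplicative group.\<close>

definition N :: nat where "N = Q - 1"

lemma N_pos: "N > 0" using Q_gt_1 by (simp add: N_def)

lemma X_nmem: "X \<notin> P"
proof
  assume "X \<in> P"
  then have "X ^ N \<in> P" using N_pos mult_mem2[of X "X ^ (N - 1)"] by (cases N) auto
  then show False using X_order eqv_mem one_nmem by (auto simp: N_def)
qed

lemma X_power_nmem: "X ^ i \<notin> P" using pow_mem X_nmem by blast

lemma X_power_mod: "X ^ i \<approx> X ^ (i mod N)"
proof -
  have "X ^ i = (X ^ N) ^ (i div N) * X ^ (i mod N)"
    by (simp flip: power_mult power_add)
  also have "\<dots> \<approx> 1 ^ (i div N) * X ^ (i mod N)"
    using X_order by (intro eqv_mult eqv_power) (auto simp: N_def)
  finally show ?thesis by simp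
qed

lemma X_power_cong: "[i = j] (mod N) \<Longrightarrow> X ^ i \<approx> X ^ j"
  using X_power_mod[of i] X_power_mod[of j] by (metis cong_def eqv_sym eqv_trans)

lemma X_power_inj: "X ^ i \<approx> X ^ j \<Longrightarrow> i < N \<Longrightarrow> j < N \<Longrightarrow> i = j"
proof (induction i j rule: linorder_wlog)
  case (le i j)
  have "X ^ i * 1 \<approx> X ^ i * X ^ (j - i)" using le by (simp flip: power_add)
  then have "X ^ (j - i) \<approx> 1" using eqv_cancel X_power_nmem eqv_sym by blast
  moreover have "j - i < Q - 1" using le unfolding N_def by linarith
  ultimately show ?case using X_primitive[of "j - i"] le by (cases "i = j") auto
qed (metis eqv_sym)

text \<open>The discrete logarithm to base \<open>X\<close>; it carries no information on elements of \<open>P\<close>.\<close>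

definition lg :: "'a \<Rightarrow> nat" where "lg f = (SOME i. i < N \<and> f \<approx> X ^ i)"

lemma lg: "f \<notin> P \<Longrightarrow> f \<approx> X ^ lg f"
  unfolding lg_def using someI_ex[of "\<lambda>i. i < N \<and> f \<approx> X ^ i"] exists_log[of f]
  by (auto simp: N_def)

lemma power_N: "f \<notin> P \<Longrightarrow> f ^ N \<approx> 1"
proof -
  assume f: "f \<notin> P"
  have "f * f ^ N \<approx> f * 1"
    using fixed_Q[of f] Q_gt_1 by (simp add: N_def flip: power_Suc)
  then show ?thesis using f by (rule eqv_cancel)
qed

text \<open>The elements fixed by \<open>c \<mapsto> c ^ q\<close> modulo \<open>P\<close>, a union of residue classes.\<close>

definition fixed :: "nat \<Rightarrow> 'a set" where "fixed q = {c. c ^ q \<approx> c}"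

end

text \<open>The field with \<open>Q = q ^ n\<close> elements as an extension of degree \<open>n \<ge> 2\<close> of the field \<open>F\<close> with
  \<open>q = p ^ e\<close> elements, the latter being the set of fixed points of \<open>c \<mapsto> c ^ q\<close>.\<close>

locale finite_field_extension = finite_field_model +
  fixes e n :: nat
  assumes e_pos: "e > 0" and n_ge_2: "n \<ge> 2" and Q_eq: "Q = (p ^ e) ^ n"
begin

definition q :: nat where "q = p ^ e"

abbreviation F :: "'a set" where "F \<equiv> fixed q"

lemma q_gt_1: "q > 1"
  unfolding q_def using e_pos prime_gt_1_nat[OF prime_p] by (intro one_less_power) auto

lemma F_iff: "a \<in> F \<longleftrightarrow> a ^ q \<approx> a" by (simp add: fixed_def)

lemma F_0: "0 \<in> F" and F_1: "1 \<in> F" using q_gt_1 by (auto simp: F_iff zero_power zero_mem)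

lemma F_add: "a \<in> F \<Longrightarrow> b \<in> F \<Longrightarrow> a + b \<in> F"
  unfolding F_iff unfolding q_def by (rule frobenius_fixed_add[OF prime_p p_mem])

lemma F_uminus: "a \<in> F \<Longrightarrow> - a \<in> F"
  unfolding F_iff unfolding q_def by (rule frobenius_fixed_uminus[OF prime_p p_mem])

lemma F_diff: "a \<in> F \<Longrightarrow> b \<in> F \<Longrightarrow> a - b \<in> F"
  using F_add[of a "- b"] F_uminus by simp

lemma F_mult: "a \<in> F \<Longrightarrow> b \<in> F \<Longrightarrow> a * b \<in> F"
  unfolding F_iff power_mult_distrib by (rule eqv_mult)

lemmas F_intros = F_0 F_1 F_add F_uminus F_diff F_mult

lemma frob_add: "(a + b) ^ q \<approx> a ^ q + b ^ q"
  unfolding q_def by (rule frobenius_power_add[OF prime_p p_mem])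

lemma frob_lin:
  assumes "u \<in> F" "v \<in> F"
  shows "(u + v * b) ^ q \<approx> u + v * b ^ q"
proof -
  have "(u + v * b) ^ q \<approx> u ^ q + v ^ q * b ^ q" using frob_add[of u "v * b"] by (simp add: power_mult_distrib)
  also have "\<dots> \<approx> u + v * b ^ q" using assms by (intro eqv_add eqv_mult) (auto simp: F_iff)
  finally show ?thesis .
qed

lemma q_lt_Q: "q < Q"
proof -
  have "q ^ 1 < q ^ n" using n_ge_2 q_gt_1 by (intro power_strict_increasing) auto
  then show ?thesis by (simp add: Q_eq q_def)
qed

lemma N_eq: "N = (q - 1) * (\<Sum>i<n. q ^ i)"
proof -
  have "int N = int q ^ n - 1" unfolding N_def using Q_gt_1 by (simp add: of_nat_diff Q_eq flip: q_def)
  also have "\<dots> = (int q - 1) * (\<Sum>i<n. int q ^ i)" by (rule power_diff_1_eq)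
  also have "\<dots> = int ((q - 1) * (\<Sum>i<n. q ^ i))" using q_gt_1 by (simp add: of_nat_diff)
  finally show ?thesis by (simp only: of_nat_eq_iff)
qed

lemma X_nmem_F: "X \<notin> F"
proof
  assume "X \<in> F"
  then have "X * X ^ (q - 1) \<approx> X * 1" using q_gt_1 by (simp add: F_iff flip: power_Suc)
  then have "X ^ (q - 1) \<approx> 1" using X_nmem by (rule eqv_cancel)
  moreover have "0 < q - 1" "q - 1 < Q - 1" using q_gt_1 q_lt_Q by linarith+
  ultimately show False using X_primitive by blast
qed

text \<open>Representatives of the \<open>q\<close> residue classes in \<open>F\<close>: zero and the powers of \<open>X\<close> whose exponent is
  a multiple of \<open>N / (q - 1)\<close>. Only the inclusion in \<open>F\<close> and the number of classes matter below, not
  that every class in \<open>F\<close> is represented.\<close>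

lemma exists_subfield_reps:
  obtains S where "finite S" "card S = q" "S \<subseteq> F" "0 \<in> S" "\<And>c d. c \<in> S \<Longrightarrow> d \<in> S \<Longrightarrow> c \<approx> d \<Longrightarrow> c = d"
proof -
  define r where "r = (\<Sum>i<n. q ^ i)"
  have N: "N = (q - 1) * r" by (simp add: N_eq r_def)
  then have "r > 0" using N_pos by (cases r) auto
  define h where "h i = X ^ (r * i)" for i
  have hi: "i = j" if "h i \<approx> h j" "i < q - 1" "j < q - 1" for i j
  proof -
    have "r * i < N" "r * j < N" using that \<open>r > 0\<close> by (auto simp: N mult.commute)
    then have "r * i = r * j" using that(1) unfolding h_def by (intro X_power_inj)
    then show ?thesis using \<open>r > 0\<close> by simp
  qed
  then have inj: "inj_on h {..<q - 1}" by (auto simp: inj_on_def)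
  have nP: "h i \<notin> P" for i by (simp add: h_def X_power_nmem)
  show ?thesis
  proof (rule that[of "insert 0 (h ` {..<q - 1})"])
    have "0 \<notin> h ` {..<q - 1}" using nP zero_mem by (metis imageE)
    then show "card (insert 0 (h ` {..<q - 1})) = q"
      using inj q_gt_1 by (simp add: card_image)
    have "h i \<in> F" for i
    proof -
      have "r * i * q = r * i + N * i" using q_gt_1 by (simp add: N diff_mult_distrib algebra_simps)
      then have "[r * i * q = r * i] (mod N)" by (simp add: cong_def)
      then show ?thesis unfolding F_iff h_def power_mult[symmetric] by (rule X_power_cong)
    qed
    then show "insert 0 (h ` {..<q - 1}) \<subseteq> F" using F_0 by auto
    show "c = d" if "c \<in> insert 0 (h ` {..<q - 1})" "d \<in> insert 0 (h ` {..<q - 1})" "c \<approx> d" for c d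
      using that hi nP eqv_mem[of c d] zero_mem by auto
  qed auto
qed

text \<open>An element \<open>b\<close> outside \<open>F\<close> is linearly independent of one over \<open>F\<close>: compare the relation with
  its image under the Frobenius map.\<close>

lemma basis2:
  assumes "u \<in> F" "v \<in> F" "b \<notin> F" "u + v * b \<in> P"
  shows "u \<in> P" "v \<in> P"
proof -
  have "(u + v * b) ^ q \<in> P" using assms(4) q_gt_1 mult_mem2[OF assms(4), of "(u + v * b) ^ (q - 1)"]
    by (simp flip: power_Suc)
  then have "u + v * b ^ q \<in> P" using frob_lin[OF assms(1,2)] eqv_mem by blast
  then have "(u + v * b ^ q) - (u + v * b) \<in> P" using assms(4) by (rule diff_mem)
  then have "v * (b ^ q - b) \<in> P" by (simp add: algebra_simps)
  then show "v \<in> P" using prime_mem assms(3) by (auto simp: F_iff eqv_def)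
  then have "u + v * b - v * b \<in> P" by (intro diff_mem assms mult_mem2)
  then show "u \<in> P" by simp
qed

section \<open>Bose's construction\<close>

text \<open>The product of \<open>a * X + c\<close> and \<open>b * X + d\<close>, for fixed \<open>a\<close> and \<open>b\<close>, determines
  \<open>a * d + b * c\<close> and \<open>c * d\<close>, and these leave at most two possibilities for \<open>c\<close>.\<close>

lemma bose_three:
  assumes ab: "a \<in> F" "b \<in> F" "a \<notin> P" "b \<notin> P" and cd: "{c1, c2, c3, d1, d2, d3} \<subseteq> F"
    and 2: "(a * X + c1) * (b * X + d1) \<approx> (a * X + c2) * (b * X + d2)"
    and 3: "(a * X + c1) * (b * X + d1) \<approx> (a * X + c3) * (b * X + d3)"
  shows "c1 \<approx> c2 \<or> c1 \<approx> c3 \<or> c2 \<approx> c3"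
proof -
  have lin: "a * (d - d') + b * (c - c') \<in> P" and con: "c * d - c' * d' \<in> P"
    if "(a * X + c) * (b * X + d) \<approx> (a * X + c') * (b * X + d')" "{c, c', d, d'} \<subseteq> F" for c c' d d'
  proof -
    have "(c * d - c' * d') + (a * (d - d') + b * (c - c')) * X \<in> P"
      using that(1) by (simp add: eqv_def algebra_simps)
    moreover have "c * d - c' * d' \<in> F" "a * (d - d') + b * (c - c') \<in> F"
      using that(2) ab by (auto intro!: F_intros)
    ultimately show "a * (d - d') + b * (c - c') \<in> P" "c * d - c' * d' \<in> P"
      using basis2 X_nmem_F by blast+
  qed
  have step: "c \<approx> c' \<or> a * d' \<approx> b * c"
    if "(a * X + c) * (b * X + d) \<approx> (a * X + c') * (b * X + d')" "{c, c', d, d'} \<subseteq> F" for c c' d d'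
  proof -
    have "a * (c * d - c' * d') - c * (a * (d - d') + b * (c - c')) \<in> P"
      by (rule diff_mem[OF mult_mem[OF con[OF that]] mult_mem[OF lin[OF that]]])
    also have "a * (c * d - c' * d') - c * (a * (d - d') + b * (c - c')) = (c - c') * (a * d' - b * c)"
      by (simp add: algebra_simps)
    finally show ?thesis using prime_mem by (auto simp: eqv_def)
  qed
  show ?thesis
  proof (rule ccontr)
    assume n: "\<not> ?thesis"
    have "a * d2 \<approx> b * c1" "a * d3 \<approx> b * c1" using step[OF 2] step[OF 3] cd n by auto
    then have "a * d2 \<approx> a * d3" by (rule eqv_trans[OF _ eqv_sym])
    then have "a * d2 - a * d3 \<in> P" by (simp add: eqv_def)
    moreover have "(a * X + c2) * (b * X + d2) \<approx> (a * X + c3) * (b * X + d3)"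
      by (rule eqv_trans[OF eqv_sym[OF 2] 3])
    then have "a * (d2 - d3) + b * (c2 - c3) \<in> P" using cd by (intro lin) auto
    ultimately have "a * (d2 - d3) + b * (c2 - c3) - (a * d2 - a * d3) \<in> P" by (rule diff_mem[rotated])
    then have "b * (c2 - c3) \<in> P" by (simp add: algebra_simps)
    then show False using prime_mem ab(4) n by (auto simp: eqv_def)
  qed
qed

text \<open>The set of logarithms of the \<open>k * q\<close> elements \<open>a * X + c\<close>, where \<open>a\<close> runs through \<open>k\<close>
  nonzero elements of the subfield and \<open>c\<close> through all of its elements.\<close>

lemma C_ge_bose:
  assumes "n = 2" "k < q"
  shows "k * q \<le> C (2 * k\<^sup>2) N"
proof -
  obtain S where S: "finite S" "card S = q" "S \<subseteq> F" "0 \<in> S" "\<And>c d. c \<in> S \<Longrightarrow> d \<in> S \<Longrightarrow> c \<approx> d \<Longrightarrow> c = d"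
    by (rule exists_subfield_reps) (rule that)
  have "card (S - {0}) = q - 1" using S by simp
  then obtain K where K: "K \<subseteq> S - {0}" "card K = k" "finite K"
    using assms(2) obtain_subset_with_card_n[of k "S - {0}"] by (metis Suc_pred' finite_Diff finite_subset less_Suc_eq_le S(1) q_gt_1 less_trans zero_less_one)
  have KP: "a \<notin> P" "a \<in> F" if "a \<in> K" for a
    using that K(1) S(3,4) S(5)[of a 0] by auto
  have inj: "a = a' \<and> c = c'" if "a * X + c \<approx> a' * X + c'" "a \<in> K" "a' \<in> K" "c \<in> S" "c' \<in> S" for a a' c c'
  proof -
    have "(c - c') + (a - a') * X \<in> P" using that(1) by (simp add: eqv_def algebra_simps)
    moreover have "c - c' \<in> F" "a - a' \<in> F" using that KP S(3) by (auto intro!: F_intros)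
    ultimately have "c \<approx> c'" "a \<approx> a'" unfolding eqv_def using basis2 X_nmem_F by blast+
    then show ?thesis using S(5) K(1) that by blast
  qed
  have nP: "a * X + c \<notin> P" if "a \<in> K" "c \<in> S" for a c
    using basis2[of c a X] X_nmem_F KP that S(3) by (auto simp: add.commute)
  define L where "L a = (\<lambda>c. a * X + c) ` S" for a
  have "card (\<Union>a\<in>K. L a) \<le> C (2 * (card K)\<^sup>2) N"
  proof (rule card_UN_le_C[where f = "\<lambda>s. int (lg s)"])
    show "finite (L a)" for a using S by (simp add: L_def)
  next
    fix s t assume st: "s \<in> (\<Union>a\<in>K. L a)" "t \<in> (\<Union>a\<in>K. L a)" "[int (lg s) = int (lg t)] (mod int N)"
    then have "X ^ lg s \<approx> X ^ lg t" by (intro X_power_cong) (simp add: cong_int_iff)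
    moreover have "s \<notin> P" "t \<notin> P" using st nP by (auto simp: L_def)
    ultimately have "s \<approx> t" using eqv_trans[OF lg eqv_trans[OF _ eqv_sym[OF lg]]] by simp
    moreover obtain a c a' c' where "s = a * X + c" "t = a' * X + c'" "a \<in> K" "a' \<in> K" "c \<in> S" "c' \<in> S"
      using st by (auto simp: L_def)
    ultimately show "s = t" using inj[of a c a' c'] by simp
  next
    fix a b s1 s2 s3 t1 t2 t3
    assume ab: "a \<in> K" "b \<in> K" and st: "{s1, s2, s3} \<subseteq> L a" "{t1, t2, t3} \<subseteq> L b"
      and 2: "[int (lg s1) + int (lg t1) = int (lg s2) + int (lg t2)] (mod int N)"
      and 3: "[int (lg s1) + int (lg t1) = int (lg s3) + int (lg t3)] (mod int N)"
    have prod: "s * t \<approx> s' * t'"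
      if "[int (lg s) + int (lg t) = int (lg s') + int (lg t')] (mod int N)" "{s, s'} \<subseteq> L a" "{t, t'} \<subseteq> L b" for s s' t t'
    proof -
      have lg': "u * v \<approx> X ^ (lg u + lg v)" if "u \<in> L a" "v \<in> L b" for u v
        unfolding power_add using that nP ab by (intro eqv_mult lg) (auto simp: L_def)
      have "X ^ (lg s + lg t) \<approx> X ^ (lg s' + lg t')"
        using that(1) by (intro X_power_cong) (simp flip: cong_int_iff)
      then have "s * t \<approx> X ^ (lg s' + lg t')" using lg'[of s t] that by (auto intro: eqv_trans)
      then show ?thesis using eqv_trans[OF _ eqv_sym[OF lg'[of s' t']]] that by auto
    qed
    obtain c1 c2 c3 d1 d2 d3 where cd: "s1 = a * X + c1" "s2 = a * X + c2" "s3 = a * X + c3"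
      "t1 = b * X + d1" "t2 = b * X + d2" "t3 = b * X + d3" "{c1, c2, c3, d1, d2, d3} \<subseteq> S"
      using st by (auto simp: L_def)
    have "c1 \<approx> c2 \<or> c1 \<approx> c3 \<or> c2 \<approx> c3"
    proof (rule bose_three[of a b c1 c2 c3 d1 d2 d3])
      show "(a * X + c1) * (b * X + d1) \<approx> (a * X + c2) * (b * X + d2)"
        using prod[OF 2] st cd by simp
      show "(a * X + c1) * (b * X + d1) \<approx> (a * X + c3) * (b * X + d3)"
        using prod[OF 3] st cd by simp
    qed (use ab KP cd S(3) in auto)
    then show "s1 = s2 \<or> s1 = s3 \<or> s2 = s3" using S(5) cd by auto
  qed (use N_pos K in auto)
  moreover have "card (\<Union>a\<in>K. L a) = k * q"
  proof -
    have "(\<Union>a\<in>K. L a) = (\<lambda>(a, c). a * X + c) ` (K \<times> S)" by (auto simp: L_def)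
    moreover have "inj_on (\<lambda>(a, c). a * X + c) (K \<times> S)"
    proof (rule inj_onI, clarify)
      fix a c a' c' assume "a \<in> K" "c \<in> S" "a' \<in> K" "c' \<in> S" "a * X + c = a' * X + c'"
      then show "a = a' \<and> c = c'" using inj[of a c a' c'] by simp
    qed
    ultimately show ?thesis using K S by (simp add: card_image card_cartesian_product)
  qed
  ultimately show ?thesis by (simp add: K(2))
qed

end

section \<open>Singer's construction\<close>

context finite_field_extension
begin

text \<open>Proportionality over \<open>F\<close>, that is, equality of points of the projective space. For elements
  outside \<open>P\<close> the definition says that \<open>a / b\<close> is fixed by the Frobenius map.\<close>

definition proportional :: "'a \<Rightarrow> 'a \<Rightarrow> bool" where
  "proportional a b \<longleftrightarrow> a ^ q * b \<approx> a * b ^ q"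

lemma proportional_sym: "proportional a b \<Longrightarrow> proportional b a"
  unfolding proportional_def using eqv_sym by (simp add: mult.commute)

lemma proportional_mult: "proportional a b \<Longrightarrow> proportional c d \<Longrightarrow> proportional (a * c) (b * d)"
  unfolding proportional_def using eqv_mult[of "a ^ q * b" "a * b ^ q" "c ^ q * d" "c * d ^ q"]
  by (simp add: power_mult_distrib mult_ac)

lemma proportional_cancel:
  assumes "proportional (a * c) (b * c)" "c \<notin> P"
  shows "proportional a b"
proof -
  have "c ^ Suc q * (a ^ q * b) = (a * c) ^ q * (b * c)" by (simp add: power_mult_distrib mult_ac)
  also have "\<dots> \<approx> a * c * (b * c) ^ q" using assms(1) by (simp add: proportional_def)
  also have "\<dots> = c ^ Suc q * (a * b ^ q)" by (simp add: power_mult_distrib mult_ac)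
  finally show ?thesis unfolding proportional_def
    by (rule eqv_cancel) (use pow_mem[of c "Suc q"] assms(2) in blast)
qed

lemma proportional_refl: "proportional a a" by (simp add: proportional_def mult.commute)

lemma proportional_factor:
  assumes "proportional a b" "a \<notin> P" "b \<notin> P"
  obtains l where "l \<in> F" "l \<notin> P" "a \<approx> l * b"
proof -
  define l where "l = a * b ^ (N - 1)"
  have "l * b = a * b ^ N" using N_pos by (simp add: l_def mult.assoc flip: power_Suc2)
  also have "\<dots> \<approx> a * 1" using power_N assms by (intro eqv_mult) auto
  finally have lb: "l * b \<approx> a" by simp
  have "l \<notin> P"
  proof
    assume "l \<in> P"
    then have "l * b \<in> P" by (rule mult_mem2)
    then show False using eqv_mem[OF lb] assms by simp
  qed
  moreover have "l \<in> F"
  proof -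
    have "b ^ Suc q * l ^ q = (l * b) ^ q * b" by (simp add: power_mult_distrib mult_ac)
    also have "\<dots> \<approx> a ^ q * b" by (intro eqv_mult eqv_power lb eqv_refl)
    also have "\<dots> \<approx> a * b ^ q" using assms(1) by (simp add: proportional_def)
    also have "\<dots> \<approx> (l * b) * b ^ q" by (intro eqv_mult eqv_sym[OF lb] eqv_refl)
    also have "\<dots> = b ^ Suc q * l" by (simp add: mult_ac)
    finally have "b ^ Suc q * l ^ q \<approx> b ^ Suc q * l" .
    then have "l ^ q \<approx> l" by (rule eqv_cancel) (use pow_mem[of b "Suc q"] assms(3) in blast)
    then show ?thesis by (simp add: F_iff)
  qed
  ultimately show ?thesis using that eqv_sym[OF lb] by blast
qed

lemma proportionalI:
  assumes "l \<in> F" "m \<in> F" "l \<notin> P" "l * a \<approx> m * b"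
  shows "proportional a b"
proof -
  have "l ^ Suc 1 * (a ^ q * b) = l * (l * a ^ q * b)" by (simp add: mult_ac)
  also have "\<dots> \<approx> l * (l ^ q * a ^ q * b)"
    using assms(1) by (intro eqv_mult eqv_refl) (simp add: F_iff eqv_sym)
  also have "\<dots> = l * b * (l * a) ^ q" by (simp add: power_mult_distrib mult_ac)
  also have "\<dots> \<approx> l * b * (m * b) ^ q" by (intro eqv_mult eqv_power assms eqv_refl)
  also have "\<dots> = l * b * b ^ q * m ^ q" by (simp add: power_mult_distrib mult_ac)
  also have "\<dots> \<approx> l * b * b ^ q * m"
    using assms(2) by (intro eqv_mult eqv_refl) (simp add: F_iff)
  also have "\<dots> = l * b ^ q * (m * b)" by (simp add: mult_ac)
  also have "\<dots> \<approx> l * b ^ q * (l * a)" by (intro eqv_mult eqv_refl eqv_sym[OF assms(4)])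
  also have "\<dots> = l ^ Suc 1 * (a * b ^ q)" by (simp add: mult_ac)
  finally have "l ^ Suc 1 * (a ^ q * b) \<approx> l ^ Suc 1 * (a * b ^ q)" .
  then show ?thesis unfolding proportional_def
    by (rule eqv_cancel) (use pow_mem[of l "Suc 1"] assms(3) in blast)
qed

text \<open>The modulus is \<open>(q ^ n - 1) / (q - 1)\<close>, the index of the multiplicative group of \<open>F\<close>.\<close>

lemma proportional_X_power:
  assumes "[i = j] (mod (\<Sum>i<n. q ^ i))" "a \<approx> X ^ i" "b \<approx> X ^ j"
  shows "proportional a b"
proof -
  have *: "i * q + j = i + j + (q - 1) * i" "i + j * q = i + j + (q - 1) * j"
    using q_gt_1 by (cases q; simp add: algebra_simps)+
  have "[(q - 1) * i = (q - 1) * j] (mod N)"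
    unfolding N_eq using assms(1) by (simp add: cong_def flip: mult_mod_right)
  then have "[i * q + j = i + j * q] (mod N)" unfolding * by (rule cong_add[OF cong_refl])
  have "a ^ q * b \<approx> (X ^ i) ^ q * X ^ j" by (intro eqv_mult eqv_power assms)
  also have "\<dots> = X ^ (i * q + j)" by (simp add: power_add power_mult)
  also have "\<dots> \<approx> X ^ (i + j * q)" by (rule X_power_cong) fact
  also have "\<dots> = X ^ i * (X ^ j) ^ q" by (simp add: power_add power_mult)
  also have "\<dots> \<approx> a * b ^ q" by (intro eqv_mult eqv_power eqv_sym[OF assms(2)] eqv_sym[OF assms(3)])
  finally show ?thesis by (simp add: proportional_def)
qed

text \<open>A vanishing determinant of coordinates with respect to \<open>1\<close> and \<open>b\<close> forces proportionality.\<close>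

lemma proportional_span2:
  assumes "y \<in> F" "z \<in> F" "y' \<in> F" "z' \<in> F" "y * z' - y' * z \<in> P"
  shows "proportional (y + z * b) (y' + z' * b)"
proof -
  have "(y + z * b) ^ q * (y' + z' * b) \<approx> (y + z * b ^ q) * (y' + z' * b)"
    by (intro eqv_mult frob_lin assms eqv_refl)
  also have "\<dots> \<approx> (y + z * b) * (y' + z' * b ^ q)"
  proof -
    have "(y + z * b ^ q) * (y' + z' * b) - (y + z * b) * (y' + z' * b ^ q) = (y * z' - y' * z) * (b - b ^ q)"
      by (simp add: algebra_simps)
    then show ?thesis unfolding eqv_def using mult_mem2[OF assms(5)] by simp
  qed
  also have "\<dots> \<approx> (y + z * b) * (y' + z' * b) ^ q"
    by (intro eqv_mult eqv_sym[OF frob_lin] assms eqv_refl)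
  finally show ?thesis by (simp add: proportional_def)
qed

end

text \<open>The cubic case, in which \<open>N / (q - 1) = q\<^sup>2 + q + 1\<close>.\<close>

locale cubic_extension = finite_field_extension +
  assumes n3: "n = 3"
begin

lemma Q_cubic: "Q = q * q * q" using n3 by (simp add: Q_eq power3_eq_cube flip: q_def)

text \<open>In a cubic extension no element outside \<open>F\<close> satisfies a nontrivial quadratic equation over
  \<open>F\<close>, because its three conjugates \<open>t\<close>, \<open>t ^ q\<close>, \<open>t ^ (q\<^sup>2)\<close> are distinct.\<close>

lemma basis3:
  assumes F: "u \<in> F" "v \<in> F" "w \<in> F" and t: "t \<notin> F" and 0: "u * t\<^sup>2 + v * t + w \<in> P"
  shows "u \<in> P" "v \<in> P" "w \<in> P"
proof -
  define g where "g s = u * s\<^sup>2 + v * s + w" for s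
  have g: "g (s ^ q) \<in> P" if "g s \<in> P" for s
  proof -
    have "g s ^ q \<approx> (u * s\<^sup>2 + v * s) ^ q + w ^ q" unfolding g_def by (rule frob_add)
    also have "\<dots> \<approx> ((u * s\<^sup>2) ^ q + (v * s) ^ q) + w ^ q" by (intro eqv_add frob_add eqv_refl)
    also have "\<dots> = (u ^ q * (s ^ q)\<^sup>2 + v ^ q * s ^ q) + w ^ q"
      by (simp add: power_mult_distrib mult.commute flip: power_mult)
    also have "\<dots> \<approx> g (s ^ q)" unfolding g_def using F by (intro eqv_add eqv_mult eqv_refl) (auto simp: F_iff)
    finally have "g s ^ q \<approx> g (s ^ q)" .
    moreover have "g s ^ q \<in> P" using that q_gt_1 mult_mem2[of "g s" "g s ^ (q - 1)"] by (simp flip: power_Suc)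
    ultimately show ?thesis using eqv_mem by blast
  qed
  define t1 t2 where "t1 = t ^ q" and "t2 = t1 ^ q"
  have t3: "t2 ^ q \<approx> t" using fixed_Q[of t] by (simp add: t1_def t2_def Q_cubic power_mult)
  have n01: "t - t1 \<notin> P" using t by (metis F_iff eqv_def eqv_sym t1_def)
  have n12: "t1 - t2 \<notin> P"
  proof
    assume "t1 - t2 \<in> P"
    then have "t1 ^ q \<approx> t2 ^ q" by (intro eqv_power) (simp add: eqv_def)
    then have "t2 \<approx> t" using t3 unfolding t2_def[symmetric] by (rule eqv_trans)
    then have "t1 \<approx> t" using \<open>t1 - t2 \<in> P\<close> eqv_trans[of t1 t2 t] by (simp add: eqv_def)
    then show False using n01 eqv_sym by (auto simp: eqv_def)
  qed
  have n02: "t - t2 \<notin> P"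
  proof
    assume "t - t2 \<in> P"
    then have "t ^ q \<approx> t2 ^ q" by (intro eqv_power) (simp add: eqv_def)
    then have "t1 \<approx> t" using t3 unfolding t1_def[symmetric] by (rule eqv_trans)
    then show False using n01 eqv_sym by (auto simp: eqv_def)
  qed
  have g0: "g t \<in> P" using 0 by (simp add: g_def)
  then have g1: "g t1 \<in> P" unfolding t1_def by (rule g)
  then have g2: "g t2 \<in> P" unfolding t2_def by (rule g)
  have div: "u * (s + s') + v \<in> P" if "g s \<in> P" "g s' \<in> P" "s - s' \<notin> P" for s s'
  proof -
    have "(s - s') * (u * (s + s') + v) = g s - g s'" by (simp add: g_def power2_eq_square algebra_simps)
    then show ?thesis using diff_mem[OF that(1,2)] prime_mem that(3) by metis
  qed
  have "(u * (t + t1) + v) - (u * (t1 + t2) + v) \<in> P"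
    by (rule diff_mem[OF div[OF g0 g1 n01] div[OF g1 g2 n12]])
  then have "u * (t - t2) \<in> P" by (simp add: algebra_simps)
  then show uP: "u \<in> P" using prime_mem n02 by blast
  have "(u * (t + t1) + v) - u * (t + t1) \<in> P"
    by (rule diff_mem[OF div[OF g0 g1 n01] mult_mem2[OF uP]])
  then show vP: "v \<in> P" by simp
  have "(u * t\<^sup>2 + v * t + w) - (u * t\<^sup>2 + v * t) \<in> P"
    by (rule diff_mem[OF 0 add_mem[OF mult_mem2[OF uP] mult_mem2[OF vP]]])
  then show "w \<in> P" by simp
qed

text \<open>The homogeneous version of the preceding lemma, applied to the ratio of \<open>x\<close> and \<open>y\<close>.\<close>

lemma quadratic_form:
  assumes F: "u \<in> F" "v \<in> F" "w \<in> F" and n: "\<not> proportional x y" "x \<notin> P" "y \<notin> P"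
    and 0: "u * x\<^sup>2 + v * (x * y) + w * y\<^sup>2 \<in> P"
  shows "w \<in> P"
proof -
  define z where "z = y ^ (N - 1)"
  have yz: "y * z \<approx> 1" using power_N[OF n(3)] N_pos by (simp add: z_def flip: power_Suc)
  define t where "t = x * z"
  have "t \<notin> F"
  proof
    assume "t \<in> F"
    have "t * y \<approx> x * 1" unfolding t_def using eqv_mult[OF eqv_refl[of x] yz] by (simp add: mult_ac)
    then have "1 * x \<approx> t * y" using eqv_sym by simp
    then show False using proportionalI[of 1 t x y] \<open>t \<in> F\<close> F_1 one_nmem n(1) by simp
  qed
  moreover have "u * t\<^sup>2 + v * t + w \<in> P"
  proof -
    have "u * t\<^sup>2 + v * t * 1 + w * 1\<^sup>2 \<approx> u * t\<^sup>2 + v * t * (y * z) + w * (y * z)\<^sup>2"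
      by (intro eqv_add eqv_mult eqv_power eqv_refl eqv_sym[OF yz])
    also have "\<dots> = z\<^sup>2 * (u * x\<^sup>2 + v * (x * y) + w * y\<^sup>2)"
      by (simp add: t_def power2_eq_square algebra_simps)
    finally have "u * t\<^sup>2 + v * t + w \<approx> z\<^sup>2 * (u * x\<^sup>2 + v * (x * y) + w * y\<^sup>2)" by simp
    then show ?thesis using mult_mem[OF 0] by (simp add: eqv_mem)
  qed
  ultimately show ?thesis by (rule basis3(3)[OF F])
qed

text \<open>Three points \<open>s\<^sub>i\<close> of the line spanned by \<open>1\<close> and \<open>a\<close>, and three points \<open>t\<^sub>i\<close> of the line
  spanned by \<open>1\<close> and \<open>b\<close>. The vectors of two-by-two minors of the coordinates give linear relations
  \<open>c\<^sub>1 * t\<^sub>1 + c\<^sub>2 * t\<^sub>2 + c\<^sub>3 * t\<^sub>3 = 0\<close> and \<open>d\<^sub>1 * s\<^sub>1 + d\<^sub>2 * s\<^sub>2 + d\<^sub>3 * s\<^sub>3 = 0\<close>. Multiplying the first by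
  \<open>s\<^sub>1 * s\<^sub>2 * s\<^sub>3\<close>, cancelling the common product \<open>s\<^sub>1 * t\<^sub>1\<close> and eliminating \<open>s\<^sub>3\<close> with the second
  yields a quadratic relation between \<open>s\<^sub>1\<close> and \<open>s\<^sub>2\<close>.\<close>

lemma singer_three:
  assumes F: "{y1, y2, y3, z1, z2, z3} \<subseteq> F" "{y1', y2', y3', z1', z2', z3'} \<subseteq> F"
    and s: "s1 = y1 + z1 * a" "s2 = y2 + z2 * a" "s3 = y3 + z3 * a"
    and t: "t1 = y1' + z1' * b" "t2 = y2' + z2' * b" "t3 = y3' + z3' * b"
    and nP: "s1 \<notin> P" "s2 \<notin> P" "s3 \<notin> P" "t1 \<notin> P" "t2 \<notin> P" "t3 \<notin> P"
    and pr: "proportional (s1 * t1) (s2 * t2)" "proportional (s1 * t1) (s3 * t3)" "proportional (s2 * t2) (s3 * t3)"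
  shows "proportional s1 s2 \<or> proportional s1 s3 \<or> proportional s2 s3"
proof (rule ccontr)
  assume n: "\<not> ?thesis"
  have nt: "\<not> proportional t t'" if "\<not> proportional s s'" "proportional (s * t) (s' * t')" "t \<notin> P" "t' \<notin> P" for s s' t t'
  proof
    assume "proportional t t'"
    then have "proportional (s * t * t') (s' * t' * t)" by (intro proportional_mult that proportional_sym[of t t'])
    then have "proportional (s * (t * t')) (s' * (t * t'))" by (simp add: mult_ac)
    then have "proportional s s'" using proportional_cancel prime_mem that by blast
    then show False using that by simp
  qed
  define c1 c2 c3 where "c1 = y2' * z3' - y3' * z2'" and "c2 = y3' * z1' - y1' * z3'" and "c3 = y1' * z2' - y2' * z1'"
  define d1 d2 d3 where "d1 = y2 * z3 - y3 * z2" and "d2 = y3 * z1 - y1 * z3" and "d3 = y1 * z2 - y2 * z1"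
  have cF: "c1 \<in> F" "c2 \<in> F" "c3 \<in> F" "d1 \<in> F" "d2 \<in> F" "d3 \<in> F"
    using F by (auto simp: c1_def c2_def c3_def d1_def d2_def d3_def intro!: F_diff F_mult)
  have c1P: "c1 \<notin> P"
  proof
    assume "c1 \<in> P"
    then have "proportional t2 t3" unfolding t c1_def using F by (intro proportional_span2) auto
    then show False using nt[of s2 s3 t2 t3] n nP pr by blast
  qed
  have d2P: "d2 \<notin> P"
  proof
    assume "d2 \<in> P"
    then have "proportional s3 s1" unfolding s d2_def using F by (intro proportional_span2) auto
    then show False using n proportional_sym by blast
  qed
  have c0: "c1 * t1 + c2 * t2 + c3 * t3 = 0" unfolding t c1_def c2_def c3_def by (simp add: algebra_simps)
  have d0: "d3 * s3 = - (d1 * s1 + d2 * s2)" unfolding s d1_def d2_def d3_def by (simp add: algebra_simps)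
  have st: "s1 * t1 \<notin> P" "s2 * t2 \<notin> P" "s3 * t3 \<notin> P" using prime_mem nP by blast+
  obtain l2 where l2: "l2 \<in> F" "s2 * t2 \<approx> l2 * (s1 * t1)"
    using proportional_factor[OF proportional_sym[OF pr(1)] st(2,1)] by metis
  obtain l3 where l3: "l3 \<in> F" "s3 * t3 \<approx> l3 * (s1 * t1)"
    using proportional_factor[OF proportional_sym[OF pr(2)] st(3,1)] by metis
  define A where "A = c1 * (s2 * s3) + c2 * l2 * (s1 * s3) + c3 * l3 * (s1 * s2)"
  have "A \<in> P"
  proof -
    have "(s1 * t1) * A = c1 * (s1 * t1) * (s2 * s3) + c2 * (l2 * (s1 * t1)) * (s1 * s3) + c3 * (l3 * (s1 * t1)) * (s1 * s2)"
      by (simp add: A_def algebra_simps)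
    also have "\<dots> \<approx> c1 * (s1 * t1) * (s2 * s3) + c2 * (s2 * t2) * (s1 * s3) + c3 * (s3 * t3) * (s1 * s2)"
      by (intro eqv_add eqv_mult eqv_refl eqv_sym[OF l2(2)] eqv_sym[OF l3(2)])
    also have "\<dots> = s1 * s2 * s3 * (c1 * t1 + c2 * t2 + c3 * t3)" by (simp add: algebra_simps)
    also have "\<dots> = 0" by (simp add: c0)
    finally have "(s1 * t1) * A \<in> P" by simp
    then show ?thesis using st(1) prime_mem by blast
  qed
  have "- (d3 * A) = - (c1 * s2 * (d3 * s3) + c2 * l2 * s1 * (d3 * s3) + d3 * c3 * l3 * (s1 * s2))"
    by (simp add: A_def algebra_simps)
  also have "\<dots> = (c2 * l2 * d1) * s1\<^sup>2 + (c1 * d1 + c2 * l2 * d2 - d3 * c3 * l3) * (s1 * s2) + (c1 * d2) * s2\<^sup>2"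
    unfolding d0 by (simp add: power2_eq_square algebra_simps)
  finally have "(c2 * l2 * d1) * s1\<^sup>2 + (c1 * d1 + c2 * l2 * d2 - d3 * c3 * l3) * (s1 * s2) + (c1 * d2) * s2\<^sup>2 \<in> P"
    using uminus_mem[OF mult_mem[OF \<open>A \<in> P\<close>, of d3]] by simp
  then have "c1 * d2 \<in> P"
    using n nP cF l2 l3 by (intro quadratic_form[of "c2 * l2 * d1" "c1 * d1 + c2 * l2 * d2 - d3 * c3 * l3" "c1 * d2" s1 s2])
      (auto intro!: F_intros)
  then show False using prime_mem c1P d2P by blast
qed

text \<open>The lines spanned by \<open>1\<close> and \<open>X\<^sup>2 + a * X\<close>, for \<open>k\<close> elements \<open>a\<close> of the subfield, all pass
  through the point \<open>1\<close> and are otherwise disjoint, so their union has \<open>k * q + 1\<close> points.\<close>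

lemma C_ge_singer:
  assumes "0 < k" "k < q"
  shows "k * q + 1 \<le> C (2 * k\<^sup>2) (q\<^sup>2 + q + 1)"
proof -
  define M where "M = q\<^sup>2 + q + 1"
  have M: "M = (\<Sum>i<n. q ^ i)" by (simp add: M_def n3 numeral_3_eq_3 power2_eq_square)
  obtain S where S: "finite S" "card S = q" "S \<subseteq> F" "0 \<in> S" "\<And>c d. c \<in> S \<Longrightarrow> d \<in> S \<Longrightarrow> c \<approx> d \<Longrightarrow> c = d"
    by (rule exists_subfield_reps) (rule that)
  obtain K where K: "K \<subseteq> S" "card K = k" "finite K"
    using assms(2) obtain_subset_with_card_n[of k S] S(1,2) by (metis finite_subset less_imp_le)
  have inF: "c \<in> F" if "c \<in> S" for c using that S(3) by auto
  define h where "h = (\<lambda>(a, c). c + 1 * (X\<^sup>2 + a * X))"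
  have h_form: "h (a, c) = 1 * X\<^sup>2 + a * X + c" for a c by (simp add: h_def algebra_simps)
  have hP: "h (a, c) \<notin> P" if "a \<in> F" "c \<in> F" for a c
    using basis3(1)[of 1 a c X] that X_nmem_F F_1 one_nmem by (auto simp: h_form)
  have h1: "\<not> proportional (h (a, c)) 1" if ac: "a \<in> F" "c \<in> F" for a c
  proof
    assume "proportional (h (a, c)) 1"
    then obtain l where l: "l \<in> F" "h (a, c) \<approx> l * 1"
      using proportional_factor hP[OF ac] one_nmem by metis
    then have "1 * X\<^sup>2 + a * X + (c - l) \<in> P" by (simp add: eqv_def h_form algebra_simps)
    then show False using basis3(1)[of 1 a "c - l" X] ac l X_nmem_F F_1 F_diff one_nmem by blast
  qed
  have h2: "a = a' \<and> c = c'" if ac: "a \<in> S" "c \<in> S" "a' \<in> S" "c' \<in> S" "proportional (h (a, c)) (h (a', c'))" for a c a' c'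
  proof -
    obtain l where l: "l \<in> F" "h (a, c) \<approx> l * h (a', c')"
      using proportional_factor[OF ac(5)] hP ac(1-4) inF by metis
    then have *: "(1 - l) * X\<^sup>2 + (a - l * a') * X + (c - l * c') \<in> P"
      by (simp add: eqv_def h_form algebra_simps)
    have "1 - l \<in> F" "a - l * a' \<in> F" "c - l * c' \<in> F" using ac l inF by (auto intro!: F_intros)
    from basis3[OF this X_nmem_F *] have e: "1 \<approx> l" "a \<approx> l * a'" "c \<approx> l * c'" by (auto simp: eqv_def)
    have "l * a' \<approx> 1 * a'" "l * c' \<approx> 1 * c'" by (intro eqv_mult eqv_sym[OF e(1)] eqv_refl)+
    then have "a \<approx> a'" "c \<approx> c'" using eqv_trans[OF e(2)] eqv_trans[OF e(3)] by simp_all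
    then show ?thesis using S(5) ac by blast
  qed
  define L where "L a = insert 1 ((\<lambda>c. h (a, c)) ` S)" for a
  have nP: "s \<notin> P" if "s \<in> L a" "a \<in> K" for s a
    using that hP inF K(1) one_nmem by (auto simp: L_def)
  have sep: "s = t" if st: "s \<in> L a" "t \<in> L b" "a \<in> K" "b \<in> K" "proportional s t" for s t a b
  proof -
    have ab: "a \<in> S" "b \<in> S" using st K(1) by auto
    consider "s = 1" "t = 1" | c where "s = 1" "t = h (b, c)" "c \<in> S" | c where "s = h (a, c)" "t = 1" "c \<in> S"
      | c d where "s = h (a, c)" "t = h (b, d)" "c \<in> S" "d \<in> S"
      using st(1,2) by (auto simp: L_def)
    then show ?thesis
    proof cases
      case 2
      then show ?thesis using h1[of b c] proportional_sym st(5) ab inF by blast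
    next
      case 3
      then show ?thesis using h1[of a c] st(5) ab inF by blast
    next
      case 4
      then show ?thesis using h2[of a c b d] st(5) ab by simp
    qed simp
  qed
  have "card (\<Union>a\<in>K. L a) \<le> C (2 * (card K)\<^sup>2) M"
  proof (rule card_UN_le_C[where f = "\<lambda>s. int (lg s)"])
    show "finite (L a)" for a using S by (simp add: L_def)
  next
    fix s t assume st: "s \<in> (\<Union>a\<in>K. L a)" "t \<in> (\<Union>a\<in>K. L a)" "[int (lg s) = int (lg t)] (mod int M)"
    then obtain a b where ab: "s \<in> L a" "t \<in> L b" "a \<in> K" "b \<in> K" by auto
    have "[lg s = lg t] (mod (\<Sum>i<n. q ^ i))" using st(3) unfolding cong_int_iff M .
    then have "proportional s t" using nP ab by (intro proportional_X_power[of "lg s" "lg t"] lg) auto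
    then show "s = t" using sep ab by blast
  next
    fix a b s1 s2 s3 t1 t2 t3
    assume ab: "a \<in> K" "b \<in> K" and st: "{s1, s2, s3} \<subseteq> L a" "{t1, t2, t3} \<subseteq> L b"
      and 2: "[int (lg s1) + int (lg t1) = int (lg s2) + int (lg t2)] (mod int M)"
      and 3: "[int (lg s1) + int (lg t1) = int (lg s3) + int (lg t3)] (mod int M)"
    have 4: "[int (lg s2) + int (lg t2) = int (lg s3) + int (lg t3)] (mod int M)"
      using cong_trans[OF cong_sym[OF 2] 3] .
    have prod: "proportional (s * t) (s' * t')"
      if "[int (lg s) + int (lg t) = int (lg s') + int (lg t')] (mod int M)" "{s, s'} \<subseteq> L a" "{t, t'} \<subseteq> L b" for s s' t t'
    proof -
      have lg': "u * v \<approx> X ^ (lg u + lg v)" if "u \<in> L a" "v \<in> L b" for u v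
        unfolding power_add using that nP ab by (intro eqv_mult lg) auto
      have "[lg s + lg t = lg s' + lg t'] (mod (\<Sum>i<n. q ^ i))"
        using that(1) by (simp flip: cong_int_iff M)
      then show ?thesis using that(2,3) by (intro proportional_X_power[OF _ lg' lg']) auto
    qed
    have form: "\<exists>y\<in>F. \<exists>z\<in>F. s = y + z * (X\<^sup>2 + a * X)" if sL: "s \<in> L a" for s a
    proof (cases "s = 1")
      case True
      then show ?thesis using F_0 F_1 by (intro bexI[of _ 1] bexI[of _ 0]) auto
    next
      case False
      then obtain c where "c \<in> S" "s = c + 1 * (X\<^sup>2 + a * X)" using sL by (auto simp: L_def h_def)
      then show ?thesis using F_1 inF by blast
    qed
    obtain y1 z1 where y1: "y1 \<in> F" "z1 \<in> F" "s1 = y1 + z1 * (X\<^sup>2 + a * X)" using form st by blast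
    obtain y2 z2 where y2: "y2 \<in> F" "z2 \<in> F" "s2 = y2 + z2 * (X\<^sup>2 + a * X)" using form st by blast
    obtain y3 z3 where y3: "y3 \<in> F" "z3 \<in> F" "s3 = y3 + z3 * (X\<^sup>2 + a * X)" using form st by blast
    obtain u1 v1 where u1: "u1 \<in> F" "v1 \<in> F" "t1 = u1 + v1 * (X\<^sup>2 + b * X)" using form st by blast
    obtain u2 v2 where u2: "u2 \<in> F" "v2 \<in> F" "t2 = u2 + v2 * (X\<^sup>2 + b * X)" using form st by blast
    obtain u3 v3 where u3: "u3 \<in> F" "v3 \<in> F" "t3 = u3 + v3 * (X\<^sup>2 + b * X)" using form st by blast
    have "proportional s1 s2 \<or> proportional s1 s3 \<or> proportional s2 s3"
    proof (rule singer_three[OF _ _ y1(3) y2(3) y3(3) u1(3) u2(3) u3(3)])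
      show "s1 \<notin> P" "s2 \<notin> P" "s3 \<notin> P" "t1 \<notin> P" "t2 \<notin> P" "t3 \<notin> P" using st ab nP by auto
      show "proportional (s1 * t1) (s2 * t2)" "proportional (s1 * t1) (s3 * t3)" "proportional (s2 * t2) (s3 * t3)"
        using st by (auto intro: prod 2 3 4)
    qed (use y1 y2 y3 u1 u2 u3 in auto)
    then show "s1 = s2 \<or> s1 = s3 \<or> s2 = s3" using sep st ab by auto
  qed (use K in \<open>auto simp: M_def\<close>)
  moreover have "card (\<Union>a\<in>K. L a) = k * q + 1"
  proof -
    have "(\<Union>a\<in>K. L a) = insert 1 (h ` (K \<times> S))" using K assms(1) by (auto simp: L_def)
    moreover have "1 \<notin> h ` (K \<times> S)"
    proof
      assume "1 \<in> h ` (K \<times> S)"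
      then obtain a c where "h (a, c) = 1" "a \<in> K" "c \<in> S" by force
      then show False using h1[of a c] proportional_refl[of 1] inF K(1) by auto
    qed
    moreover have "inj_on h (K \<times> S)"
    proof (rule inj_onI)
      fix u v assume "u \<in> K \<times> S" "v \<in> K \<times> S" "h u = h v"
      then show "u = v" using h2[of "fst u" "snd u" "fst v" "snd v"] K(1) proportional_refl[of "h u"] by (cases u; cases v) auto
    qed
    ultimately show ?thesis using K S by (simp add: card_image card_cartesian_product)
  qed
  ultimately show ?thesis by (simp add: K(2) M_def)
qed

end

section \<open>The six bounds\<close>

lemma finite_field_extension_exists:
  fixes q m :: nat
  assumes "primepow q" "m \<ge> 2"
  obtains P :: "int poly set" and p e where "finite_field_extension P p (q ^ m) [:0, 1:] e m" "q = p ^ e"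
proof -
  obtain p e where pe: "prime p" "e > 0" "q = p ^ e" using assms(1) by (auto simp: primepow_def)
  have "q > 1" using primepow_gt_Suc_0[OF assms(1)] by simp
  then have Q1: "q ^ m > 1" using assms(2) by (intro one_less_power) auto
  have Q: "q ^ m = p ^ (e * m)" by (simp add: pe power_mult)
  obtain P :: "int poly set" where P: "prime_ideal P" "of_nat p \<in> P" "[:0, 1:] ^ (q ^ m - 1) - 1 \<in> P"
    "\<And>f. f ^ (q ^ m) - f \<in> P"
    "\<And>i. 0 < i \<Longrightarrow> i < q ^ m - 1 \<Longrightarrow> [:0, 1:] ^ i - 1 \<notin> P"
    "\<And>f. f \<notin> P \<Longrightarrow> \<exists>i<q ^ m - 1. f - [:0, 1:] ^ i \<in> P"
    by (rule exists_finite_field[OF pe(1) Q Q1]) (rule that, auto)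
  interpret prime_ideal P by fact
  have "finite_field_extension P p (q ^ m) [:0, 1:] e m"
    by unfold_locales (use P pe Q1 assms(2) in \<open>auto simp: eqv_def\<close>)
  then show ?thesis using that pe(3) by blast
qed

lemma C_ge_bose_primepow:
  assumes "primepow q" "k < q"
  shows "k * q \<le> C (2 * k\<^sup>2) (q\<^sup>2 - 1)"
proof -
  obtain P :: "int poly set" and p e where P: "finite_field_extension P p (q\<^sup>2) [:0, 1:] e 2" "q = p ^ e"
    by (rule finite_field_extension_exists[OF assms(1), of 2]) auto
  interpret E: finite_field_extension P p "q\<^sup>2" "[:0, 1:]" e 2 by fact
  have "E.q = q" by (simp add: E.q_def P(2))
  then show ?thesis using E.C_ge_bose[of k] assms(2) by (simp add: E.N_def)
qed

lemma C_ge_singer_primepow: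
  assumes "primepow q" "0 < k" "k < q"
  shows "k * q + 1 \<le> C (2 * k\<^sup>2) (q\<^sup>2 + q + 1)"
proof -
  obtain P :: "int poly set" and p e where P: "finite_field_extension P p (q ^ 3) [:0, 1:] e 3" "q = p ^ e"
    by (rule finite_field_extension_exists[OF assms(1), of 3]) auto
  interpret E: cubic_extension P p "q ^ 3" "[:0, 1:]" e 3
    by (intro cubic_extension.intro P(1) cubic_extension_axioms.intro) simp
  have "E.q = q" by (simp add: E.q_def P(2))
  then show ?thesis using E.C_ge_singer[of k] assms(2,3) by simp
qed

theorem theorem2:
  fixes p q k g f x y :: nat
  assumes "primepow q"
    and "k > 0" and "g > 0" and "f > 0" and "x > 0" and "y > 0"
    and "k < q"
  shows
    "(prime p \<and> k < p \<longrightarrow> C (2 * k^2) (p^2 - p) \<ge> k * (p - 1)) \<and>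
     C (2 * k^2) (q^2 - 1) \<ge> k * q \<and>
     C (2 * k^2) (q^2 + q + 1) \<ge> k * q + 1 \<and>
     (gcd x y = 1 \<longrightarrow> C (g * f) (x * y) \<ge> C g x * C f y) \<and>
     (R (g * f) (x * y) \<ge> R (g * f) (x * y + 1 - nat \<lceil>real y / real (C f y)\<rceil>) \<and>
      R (g * f) (x * y + 1 - nat \<lceil>real y / real (C f y)\<rceil>) \<ge> R g x * C f y) \<and>
     R g (3 * g - g div 3 + 1) \<ge> g + 2 * (g div 3) + g div 6"
proof -
  have y: "C f y > 0" using assms by (intro C_pos)
  have "(prime p \<and> k < p \<longrightarrow> k * (p - 1) \<le> C (2 * k\<^sup>2) (p\<^sup>2 - p))"
    using C_ge_ruzsa by blast
  moreover have "k * q \<le> C (2 * k\<^sup>2) (q\<^sup>2 - 1)"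
    using assms by (intro C_ge_bose_primepow)
  moreover have "k * q + 1 \<le> C (2 * k\<^sup>2) (q\<^sup>2 + q + 1)"
    using assms by (intro C_ge_singer_primepow)
  moreover have "gcd x y = 1 \<longrightarrow> C g x * C f y \<le> C (g * f) (x * y)"
  proof
    assume "gcd x y = 1"
    then have "coprime x y" by (simp only: coprime_iff_gcd_eq_1)
    with assms show "C g x * C f y \<le> C (g * f) (x * y)" by (intro C_mult_ge)
  qed
  moreover have "R (g * f) (x * y + 1 - nat \<lceil>real y / real (C f y)\<rceil>) \<le> R (g * f) (x * y)"
  proof (rule R_mono)
    have "nat \<lceil>real y / real (C f y)\<rceil> \<ge> 1" using y assms by (simp add: Suc_le_eq)
    then show "x * y + 1 - nat \<lceil>real y / real (C f y)\<rceil> \<le> x * y" by simp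
  qed
  moreover have "R g x * C f y \<le> R (g * f) (x * y + 1 - nat \<lceil>real y / real (C f y)\<rceil>)"
    using assms by (intro R_dilate_ge)
  ultimately show ?thesis using R_ge_four_blocks[of g] by simp
qed

end
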